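(* Let $D$ be a ring of algebraic integers, let $R$ be an order in $D$ that is a half-factorial domain (HFD), and let $A$ be a ring with $R\subseteq A\subseteq D$. If $z\in A$ is a nonzero element with $\partial_R(z)=0$, then $z$ is a unit in $A$.
   Context: A ring of algebraic integers is the integral closure of $\mathbb{Z}$ in a finite extension of $\mathbb{Q}$. An order $R$ in a ring of algebraic integers $D$ is a subring of $D$ whose integral closure (in its quotient field) is equal to $D$. An integral domain $R$ is a half-factorial domain (HFD) if it is atomic (every nonzero nonunit is a finite product of irreducible elements) and whenever $\alpha_1\cdots\alpha_n=\beta_1\cdots\beta_m$ with all $\alpha_i,\beta_j$ irreducible in $R$, then $n=m$. If $R$ is an HFD with quotient field $K$, the boundary map $\partial_R:K\setminus\{0\}\to\mathbb{Z}$ is defined as follows: write $x=a/b$ with $a,b\in R\setminus\{0\}$, factor $a$ as (a unit times) a product of $n$ irreducibles of $R$ and $b$ as (a unit times) a product of $m$ irreducibles of $R$, and set $\partial_R(x)=n-m$; this is well defined because $R$ is an HFD (units of $R$ have boundary $0$). *)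

theory Defs
  imports "HOL-Algebra.Algebraic_Closure_Type"
begin

text \<open>
  The ambient field is a type \<open>'a :: field_char_0\<close>; number fields and their subrings are subsets
  of it. Notions of \<open>HOL-Algebra\<close> apply to these subsets through \<^const>\<open>ring_of_type_algebra\<close>.
\<close>

abbreviation ambient :: "'a :: field_char_0 ring"
  where "ambient \<equiv> ring_of_type_algebra"

abbreviation ring_on :: "'a :: field_char_0 set \<Rightarrow> 'a ring"
  where "ring_on S \<equiv> ambient\<lparr>carrier := S\<rparr>"

definition integral_over :: "'a :: field_char_0 set \<Rightarrow> 'a \<Rightarrow> bool"
  where "integral_over R x \<longleftrightarrow>
    (\<exists>p. lead_coeff p = 1 \<and> (\<forall>i. Polynomial.coeff p i \<in> R) \<and> poly p x = 0)"

definition integral_closure_in :: "'a :: field_char_0 set \<Rightarrow> 'a set \<Rightarrow> 'a set"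
  where "integral_closure_in R L = {x \<in> L. integral_over R x}"

lemma integral_closure_in_Ints: "integral_closure_in \<int> L = {x \<in> L. algebraic_int x}"
  by (auto simp: integral_closure_in_def integral_over_def algebraic_int.simps)

definition quotient_field :: "'a :: field_char_0 set \<Rightarrow> 'a set"
  where "quotient_field R = {a / b | a b. a \<in> R \<and> b \<in> R \<and> b \<noteq> 0}"

definition ring_of_algebraic_integers :: "'a :: field_char_0 set \<Rightarrow> bool"
  where "ring_of_algebraic_integers D \<longleftrightarrow>
    (\<exists>K. subfield K ambient \<and> ring.finite_dimension ambient \<rat> K \<and> D = integral_closure_in \<int> K)"

definition is_order_in :: "'a :: field_char_0 set \<Rightarrow> 'a set \<Rightarrow> bool"
  where "is_order_in R D \<longleftrightarrow>
    subring R ambient \<and> R \<subseteq> D \<and> integral_closure_in R (quotient_field R) = D"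

text \<open>
  As for the library's \<^locale>\<open>factorial_domain\<close>, irreducibles and factorizations are those of the
  monoid \<^term>\<open>mult_of R\<close> of nonzero elements.
\<close>

locale half_factorial_domain = domain +
  assumes atomic:
    "\<lbrakk>a \<in> carrier R; a \<noteq> \<zero>; a \<notin> Units R\<rbrakk>
      \<Longrightarrow> \<exists>fs. set fs \<subseteq> carrier (mult_of R) \<and> factors (mult_of R) fs a"
  and half_factorial:
    "\<lbrakk>set fs \<subseteq> carrier (mult_of R); factors (mult_of R) fs a;
      set gs \<subseteq> carrier (mult_of R); factors (mult_of R) gs a\<rbrakk>
      \<Longrightarrow> length fs = length gs"

context half_factorial_domain
begin

lemma wfactors_exist:
  assumes "a \<in> carrier R - {\<zero>}"
  shows "\<exists>fs. set fs \<subseteq> carrier (mult_of R) \<and> wfactors (mult_of R) fs a"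
proof (cases "a \<in> Units R")
  case True
  then have "wfactors (mult_of R) [] a" by (intro mult_of.unit_wfactors) simp
  then show ?thesis by (intro exI[of _ "[]"]) simp
next
  case False
  with assms atomic[of a] obtain fs where "set fs \<subseteq> carrier (mult_of R)" "factors (mult_of R) fs a"
    by blast
  then show ?thesis using mult_of.factors_wfactors by blast
qed

lemma wfactors_length_unique:
  assumes fs: "set fs \<subseteq> carrier (mult_of R)" "wfactors (mult_of R) fs a"
    and gs: "set gs \<subseteq> carrier (mult_of R)" "wfactors (mult_of R) gs a"
    and a: "a \<in> carrier R - {\<zero>}"
  shows "length fs = length gs"
proof (cases "a \<in> Units R")
  case True
  then have "a \<in> Units (mult_of R)" by simp
  then have "fs = []" "gs = []" using mult_of.unit_wfactors_empty fs gs by blast+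
  then show ?thesis by simp
next
  case False
  have aG: "a \<in> carrier (mult_of R)" using a by simp
  have unit_multiple: "\<exists>hs. set hs \<subseteq> carrier (mult_of R) \<and> factors (mult_of R) hs a \<and> length hs = length fs"
    if fs: "set fs \<subseteq> carrier (mult_of R)" "wfactors (mult_of R) fs a" for fs
  proof -
    obtain b where b: "factors (mult_of R) fs b" "b \<sim>\<^bsub>mult_of R\<^esub> a"
      using mult_of.wfactors_factors[OF fs(2,1)] by blast
    have bG: "b \<in> carrier (mult_of R)" using mult_of.factors_closed[OF b(1) fs(1)] .
    obtain u where u: "u \<in> Units (mult_of R)" "a = b \<otimes> u"
      using mult_of.associatedD2[of a b] mult_of.associated_sym[OF b(2)] aG bG by auto
    have nb: "b \<notin> Units (mult_of R)"
      using u False mult_of.Units_m_closed[of b u] by auto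
    have "factors (mult_of R) (fs[0 := fs ! 0 \<otimes> u]) a"
      using mult_of.factors_cong_unit[OF u(1) nb b(1) fs(1)] u(2) by simp
    moreover have "fs \<noteq> []" using mult_of.nunit_factors[OF nb b(1)] by auto
    then have "fs ! 0 \<in> carrier (mult_of R)" using fs(1) nth_mem[of 0 fs] by blast
    then have "fs ! 0 \<otimes> u \<in> carrier (mult_of R)"
      using mult_of.m_closed mult_of.Units_closed[OF u(1)] by blast
    then have "set (fs[0 := fs ! 0 \<otimes> u]) \<subseteq> carrier (mult_of R)"
      using set_update_subset_insert[of fs 0] fs(1) by blast
    ultimately show ?thesis by (intro exI[of _ "fs[0 := fs ! 0 \<otimes> u]"]) simp
  qed
  from unit_multiple[OF fs] unit_multiple[OF gs] half_factorial show ?thesis by metis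
qed

end

text \<open>
  \<^const>\<open>wfactors\<close> is factorization up to a unit; in particular units have the empty factorization.
\<close>

definition boundary_value :: "'a :: field_char_0 set \<Rightarrow> 'a \<Rightarrow> int \<Rightarrow> bool"
  where "boundary_value R x k \<longleftrightarrow>
    (\<exists>a b fs gs. a \<in> R - {0} \<and> b \<in> R - {0} \<and> x = a / b \<and>
      set fs \<subseteq> R - {0} \<and> wfactors (mult_of (ring_on R)) fs a \<and>
      set gs \<subseteq> R - {0} \<and> wfactors (mult_of (ring_on R)) gs b \<and>
      k = int (length fs) - int (length gs))"

text \<open>
  The boundary map; the value is meaningful only if \<open>R\<close> is a half-factorial domain and \<open>x\<close> is a
  nonzero element of its quotient field.
\<close>

definition boundary :: "'a :: field_char_0 set \<Rightarrow> 'a \<Rightarrow> int"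
  where "boundary R x = (THE k. boundary_value R x k)"

lemma boundary_value_ex1:
  fixes R :: "'a :: field_char_0 set"
  assumes hfd: "half_factorial_domain (ring_on R)" and x: "x \<in> quotient_field R" "x \<noteq> 0"
  shows "\<exists>!k. boundary_value R x k"
proof -
  interpret half_factorial_domain "ring_on R" by (rule hfd)
  have [simp]: "carrier (ring_on R) = R" "\<zero>\<^bsub>ambient\<^esub> = (0 :: 'a)" "x \<otimes>\<^bsub>ambient\<^esub> y = x * y"
    for x y :: 'a
    by (simp_all add: ring_of_type_algebra_def)
  have ex: "\<exists>k. boundary_value R x k"
  proof -
    obtain a b where "x = a / b" "a \<in> R - {0}" "b \<in> R - {0}"
      using x by (auto simp: quotient_field_def)
    then show ?thesis
      unfolding boundary_value_def using wfactors_exist[of a] wfactors_exist[of b] by simp blast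
  qed
  have "k = k'" if "boundary_value R x k" "boundary_value R x k'" for k k'
  proof -
    obtain a b fs gs where 1: "a \<in> R - {0}" "b \<in> R - {0}" "x = a / b"
      "set fs \<subseteq> R - {0}" "wfactors (mult_of (ring_on R)) fs a"
      "set gs \<subseteq> R - {0}" "wfactors (mult_of (ring_on R)) gs b"
      "k = int (length fs) - int (length gs)"
      using \<open>boundary_value R x k\<close> unfolding boundary_value_def by metis
    obtain a' b' fs' gs' where 2: "a' \<in> R - {0}" "b' \<in> R - {0}" "x = a' / b'"
      "set fs' \<subseteq> R - {0}" "wfactors (mult_of (ring_on R)) fs' a'"
      "set gs' \<subseteq> R - {0}" "wfactors (mult_of (ring_on R)) gs' b'"
      "k' = int (length fs') - int (length gs')"
      using \<open>boundary_value R x k'\<close> unfolding boundary_value_def by metis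
    have eq: "a * b' = a' * b" using 1(1-3) 2(1-3) by (simp add: field_simps)
    have "wfactors (mult_of (ring_on R)) (fs @ gs') (a * b')"
      using mult_of.wfactors_mult[of fs a gs' b'] 1 2 by simp
    moreover have "wfactors (mult_of (ring_on R)) (fs' @ gs) (a * b')"
      unfolding eq using mult_of.wfactors_mult[of fs' a' gs b] 1 2 by simp
    moreover have "a * b' \<in> R - {0}"
      using m_closed[of a b'] 1(1) 2(2) by simp
    ultimately have "length (fs @ gs') = length (fs' @ gs)"
      using wfactors_length_unique[of "fs @ gs'" "a * b'" "fs' @ gs"] 1 2 by simp
    then show ?thesis using 1(8) 2(8) by simp
  qed
  with ex show ?thesis by blast
qed

end

theory Submission
  imports Defs "Jordan_Normal_Form.Determinant"
begin

text \<open>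
  Let \<open>K\<close> be the quotient field of \<open>R\<close> and \<open>S\<close> its ring of integers, here described as the complete
  integral closure of \<open>R\<close>. The boundary map \<open>\<partial>\<close> is a homomorphism \<open>K - {0} \<rightarrow> \<int>\<close> that is nonnegative
  on \<open>R\<close>, vanishes on \<open>R\<close> only at units, and equals on \<open>R\<close> the number of irreducible factors. If
  \<open>m x\<^sup>n \<in> R\<close> for all \<open>n\<close>, then \<open>\<partial> m + n \<partial> x \<ge> 0\<close> for all \<open>n\<close>; hence \<open>\<partial>\<close> is nonnegative on \<open>S\<close> too. It
  suffices to show that an element \<open>z\<close> of \<open>S\<close> with \<open>\<partial> z = 0\<close> is a unit of \<open>S\<close>. Indeed, fix \<open>c > 0\<close>
  with \<open>c S \<subseteq> R\<close>. As \<open>S / c S\<close> is finite, some power of such a unit is \<open>1\<close> modulo \<open>c S\<close>, so it lies in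
  \<open>R\<close>, where boundary zero makes it a unit; and a power of \<open>z\<close> being a unit of \<open>R \<subseteq> A\<close> makes \<open>z\<close> a unit
  of \<open>A\<close>.

  Suppose that \<open>z\<close> is not a unit of \<open>S\<close>. In terms of prime ideals, the contradiction is this. Consider
  the primes of \<open>R\<close> that lie below primes of \<open>S\<close> containing \<open>z\<close>. Some power of the product of all the
  other primes of \<open>S\<close> above them that divide \<open>c\<close> is principal, with generator \<open>t\<close>. After passing to
  powers, \<open>z t\<^sup>n \<in> R\<close> for all \<open>n > 0\<close>. A nonunit factor of \<open>z t\<^sup>n\<close> in \<open>R\<close> lies in one of the chosen
  primes of \<open>R\<close>, hence shares a prime of \<open>S\<close> with \<open>z\<close>; as \<open>t\<close> is coprime to \<open>z\<close>, the number of factors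
  of \<open>z t\<^sup>n\<close> in \<open>R\<close> is bounded independently of \<open>n\<close>. But \<open>\<partial> (z t\<^sup>n) = n \<partial> t\<close>, and \<open>\<partial> t > 0\<close>, for
  otherwise \<open>z t\<close> would be a unit of \<open>R\<close>.

  No theory of prime ideals is used. Sets of primes dividing \<open>c\<close> are replaced by idempotents modulo
  \<open>c S\<close>, which exist because some power of every element is idempotent in the finite ring \<open>S / c S\<close>
  (\<open>idempotent_power\<close>). A greatest idempotent of \<open>R / c S\<close> below \<open>z\<close> (\<open>greatest_dominated_idempotent\<close>)
  describes those primes of \<open>R\<close> for which no prime of \<open>S\<close> above contains \<open>z\<close>. The element \<open>t\<close> comes from the
  finiteness of the class number (\<open>ideal_classes_finite\<close>, \<open>element_supported_on_idempotent\<close>), and the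
  bound on the number of factors from \<open>noncoprime_factors_bounded\<close>.

  All arithmetic input, namely \<open>c S \<subseteq> R\<close>, the finiteness of residue rings and that of the class
  number, follows from one approximation property (\<open>norm_approximation\<close>): with a fixed bound \<open>M\<close>, every
  \<open>x \<in> K\<close> has a multiple \<open>m x\<close>, \<open>1 \<le> m \<le> M\<close>, within norm less than \<open>1\<close> of a lattice contained in \<open>R\<close>.
  The norm is the determinant of multiplication by \<open>x\<close> on a \<open>\<rat>\<close>-basis of \<open>K\<close> in \<open>R\<close>.
\<close>

section \<open>Subrings of a field and integral elements\<close>

locale field_subring =
  fixes R :: "'a :: field_char_0 set"
  assumes one_mem [simp]: "1 \<in> R"
    and diff_mem: "x \<in> R \<Longrightarrow> y \<in> R \<Longrightarrow> x - y \<in> R"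
    and mult_mem: "x \<in> R \<Longrightarrow> y \<in> R \<Longrightarrow> x * y \<in> R"
begin

lemma zero_mem [simp]: "0 \<in> R"
  using diff_mem[of 1 1] by simp

lemma uminus_mem: "x \<in> R \<Longrightarrow> - x \<in> R"
  using diff_mem[of 0 x] by simp

lemma add_mem: "x \<in> R \<Longrightarrow> y \<in> R \<Longrightarrow> x + y \<in> R"
  using diff_mem[of x "- y"] uminus_mem by simp

lemma power_mem: "x \<in> R \<Longrightarrow> x ^ n \<in> R"
  by (induction n) (auto intro: mult_mem)

lemma of_nat_mem [simp]: "of_nat n \<in> R"
  by (induction n) (auto intro: add_mem)

lemma of_int_mem [simp]: "of_int n \<in> R"
  by (cases n rule: int_diff_cases) (auto intro: diff_mem)

lemma sum_mem: "(\<And>i. i \<in> I \<Longrightarrow> f i \<in> R) \<Longrightarrow> sum f I \<in> R"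
  by (induction I rule: infinite_finite_induct) (auto intro: add_mem)

lemma prod_list_mem: "set xs \<subseteq> R \<Longrightarrow> prod_list xs \<in> R"
  by (induction xs) (auto intro: mult_mem)

lemmas mem = diff_mem mult_mem add_mem uminus_mem power_mem sum_mem

end

text \<open>
  By the monic equation of \<open>x\<close>, all powers of \<open>x\<close> lie in any additive group that contains the first
  few of them. The bound \<open>d\<close> has to be independent of the group, which is chosen later so that it
  contains those powers.
\<close>

lemma integral_power_mem:
  fixes x :: "'a :: field_char_0"
  assumes "algebraic_int x"
  obtains d where "\<And>V n. \<lbrakk>0 \<in> V; \<And>u v. u \<in> V \<Longrightarrow> v \<in> V \<Longrightarrow> u - v \<in> V;
      \<And>(k :: int) v. v \<in> V \<Longrightarrow> of_int k * v \<in> V; \<And>i. i < d \<Longrightarrow> x ^ i \<in> V\<rbrakk> \<Longrightarrow> x ^ n \<in> V"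
proof -
  obtain p where p: "lead_coeff p = 1" "\<And>i. Polynomial.coeff p i \<in> \<int>" "poly p x = 0"
    using assms by (auto simp: algebraic_int.simps)
  define d where "d = degree p"
  have "x ^ n \<in> V" if zero: "0 \<in> V" and diff: "\<And>u v. u \<in> V \<Longrightarrow> v \<in> V \<Longrightarrow> u - v \<in> V"
    and scale: "\<And>(k :: int) v. v \<in> V \<Longrightarrow> of_int k * v \<in> V"
    and small: "\<And>i. i < d \<Longrightarrow> x ^ i \<in> V" for V n
  proof (induction n rule: less_induct)
    case (less n)
    have add: "u + v \<in> V" if "u \<in> V" "v \<in> V" for u v
      using diff[OF that(1) diff[OF zero that(2)]] by simp
    have sum: "sum f I \<in> V" if "\<And>i. i \<in> I \<Longrightarrow> f i \<in> V" for f :: "nat \<Rightarrow> 'a" and I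
      using that by (induction I rule: infinite_finite_induct) (auto simp: zero intro: add)
    show ?case
    proof (cases "n < d")
      case False
      have "0 = x ^ (n - d) * (\<Sum>i\<le>d. Polynomial.coeff p i * x ^ i)"
        using p(3) by (simp add: poly_altdef d_def)
      also have "\<dots> = x ^ (n - d) * x ^ d + x ^ (n - d) * (\<Sum>i<d. Polynomial.coeff p i * x ^ i)"
        using p(1) by (simp add: lessThan_Suc_atMost[symmetric] d_def algebra_simps)
      also have "x ^ (n - d) * x ^ d = x ^ n"
        using False by (simp flip: power_add)
      also have "x ^ (n - d) * (\<Sum>i<d. Polynomial.coeff p i * x ^ i) =
          (\<Sum>i<d. Polynomial.coeff p i * x ^ (n - d + i))"
        by (simp add: sum_distrib_left power_add mult_ac)
      finally have "x ^ n = 0 - (\<Sum>i<d. Polynomial.coeff p i * x ^ (n - d + i))"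
        by (simp add: eq_neg_iff_add_eq_0)
      moreover have "Polynomial.coeff p i * x ^ (n - d + i) \<in> V" if "i < d" for i
        using p(2)[of i] scale less[of "n - d + i"] that False by (auto elim!: Ints_cases)
      then have "(\<Sum>i<d. Polynomial.coeff p i * x ^ (n - d + i)) \<in> V"
        by (intro sum) auto
      ultimately show ?thesis
        using diff[OF zero] by simp
    qed (use small in auto)
  qed
  then show thesis using that by blast
qed

text \<open>
  An integer polynomial that vanishes at \<open>x\<close> and has nonzero constant term \<open>a\<close> shows that \<open>x\<close> divides
  \<open>a\<close>; a zero constant term is removed by cancelling \<open>x\<close>.
\<close>

lemma algebraic_int_dvd_nat:
  fixes x :: "'a :: field_char_0"
  assumes "field_subring R" "algebraic_int x" "x \<in> R" "x \<noteq> 0"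
  shows "\<exists>n>0. of_nat n / x \<in> R"
proof -
  interpret field_subring R by fact
  have "\<exists>n>0. of_nat n / x \<in> R"
    if "p \<noteq> 0" "\<And>i. Polynomial.coeff p i \<in> \<int>" "poly p x = 0" for p
    using that
  proof (induction p)
    case (pCons a p)
    obtain m where m: "a = of_int m"
      using pCons.prems(2)[of 0] by (auto elim: Ints_cases)
    have p: "Polynomial.coeff p i \<in> \<int>" for i
      using pCons.prems(2)[of "Suc i"] by simp
    show ?case
    proof (cases "m = 0")
      case True
      then show ?thesis using pCons p m assms(4) by auto
    next
      case False
      have "poly p x \<in> R"
        unfolding poly_altdef using p assms(3)
        by (intro sum_mem mult_mem power_mem) (metis Ints_cases of_int_mem)+
      moreover have "of_nat (nat \<bar>m\<bar>) / x = poly p x \<or> of_nat (nat \<bar>m\<bar>) / x = - poly p x"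
        using pCons.prems(3) m assms(4) by (auto simp: field_simps abs_if add_eq_0_iff)
      ultimately show ?thesis using False uminus_mem
        by (intro exI[of _ "nat \<bar>m\<bar>"]) auto
    qed
  qed auto
  moreover obtain p where "lead_coeff p = 1" "\<And>i. Polynomial.coeff p i \<in> \<int>" "poly p x = 0"
    using assms(2) by (auto simp: algebraic_int.simps)
  ultimately show ?thesis by (metis leading_coeff_0_iff zero_neq_one)
qed

text \<open>
  A prime in the denominator of \<open>y\<close> would occur to unbounded order in the denominators of the powers
  of \<open>y\<close>.
\<close>

lemma power_bounded_denom_int:
  fixes y :: rat
  assumes k: "k > (0 :: nat)" and *: "\<And>n. of_nat k * y ^ n \<in> \<int>"
  shows "y \<in> \<int>"
proof -
  obtain a b where y: "y = of_int a / of_int b" "coprime a b" "b > 0"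
    by (metis Fract_of_int_quotient Rat_cases)
  have "b ^ n dvd int k" for n
  proof -
    obtain m where "of_nat k * y ^ n = of_int m" using * by (auto elim: Ints_cases)
    then have "(of_int (int k * a ^ n) :: rat) = of_int (m * b ^ n)"
      using y by (simp add: field_simps)
    then have "b ^ n dvd int k * a ^ n" by (simp only: of_int_eq_iff) simp
    moreover have "coprime (b ^ n) (a ^ n)" using y(2) by (simp add: coprime_commute)
    ultimately show ?thesis by (simp add: coprime_dvd_mult_left_iff)
  qed
  then have "b ^ k \<le> int k" using k by (intro zdvd_imp_le) auto
  moreover have "int k < 2 ^ k" using of_nat_less_two_power[of k] by simp
  moreover have "2 ^ k \<le> b ^ k" if "b \<ge> 2" using that by (intro power_mono) auto
  ultimately have "\<not> b \<ge> 2" by linarith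
  then have "b = 1" using y(3) by simp
  then show ?thesis using y(1) by simp
qed

lemma common_denominator:
  fixes f :: "'b \<Rightarrow> rat"
  assumes "finite I"
  shows "\<exists>k>0. \<forall>i\<in>I. of_nat k * f i \<in> \<int>"
  using assms
proof (induction I)
  case (insert i I)
  then obtain k where k: "k > 0" "\<forall>i\<in>I. of_nat k * f i \<in> \<int>" by auto
  obtain a b where y: "f i = of_int a / of_int b" "b > 0"
    by (metis Fract_of_int_quotient Rat_cases)
  have "of_nat (k * nat b) * f i = of_int (int k * a)" using y by simp
  moreover have "of_nat (k * nat b) * f j \<in> \<int>" if "j \<in> I" for j
  proof -
    have "of_nat (k * nat b) * f j = of_nat (nat b) * (of_nat k * f j)" by simp
    also have "\<dots> \<in> \<int>" by (rule Ints_mult[OF Ints_of_nat bspec[OF k(2) that]])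
    finally show ?thesis .
  qed
  ultimately show ?case using k y
    by (intro exI[of _ "k * nat b"]) (auto simp del: of_nat_mult)
qed auto

section \<open>Orders, coordinates and the norm\<close>

interpretation Q: vector_space "\<lambda>(q :: rat) (x :: 'a :: field_char_0). of_rat q * x"
  by unfold_locales (simp_all add: algebra_simps of_rat_add of_rat_mult)

text \<open>
  These are exactly the orders of number fields: the subrings of finite rank that consist of
  algebraic integers.
\<close>

locale integer_order = field_subring +
  assumes algebraic_int_mem: "x \<in> R \<Longrightarrow> algebraic_int x"
    and finite_rank: "\<exists>F. finite F \<and> R \<subseteq> Q.span F"
begin

text \<open>
  This is the quotient field of \<open>R\<close>, as every nonzero element of \<open>R\<close> divides a positive integer in
  \<open>R\<close>. Integer denominators make the coordinate computations simpler.
\<close>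

definition K :: "'a set"
  where "K = {x. \<exists>n. n > 0 \<and> of_nat n * x \<in> R}"

lemma KI: "n > 0 \<Longrightarrow> of_nat n * x \<in> R \<Longrightarrow> x \<in> K"
  by (auto simp: K_def)

lemma KE: assumes "x \<in> K" obtains n where "n > 0" "of_nat n * x \<in> R"
  using assms by (auto simp: K_def)

lemma R_subset_K: "x \<in> R \<Longrightarrow> x \<in> K"
  by (rule KI[of 1]) auto

sublocale K: field_subring K
proof
  fix x y assume "x \<in> K" "y \<in> K"
  then obtain n m where *: "n > 0" "of_nat n * x \<in> R" "m > 0" "of_nat m * y \<in> R"
    by (auto simp: K_def)
  have "of_nat (n * m) * (x - y) = of_nat m * (of_nat n * x) - of_nat n * (of_nat m * y)"
    by (simp add: algebra_simps)
  also have "\<dots> \<in> R" by (rule diff_mem[OF mult_mem[OF of_nat_mem *(2)] mult_mem[OF of_nat_mem *(4)]])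
  finally show "x - y \<in> K" using * by (intro KI[of "n * m"]) auto
  have "of_nat (n * m) * (x * y) = (of_nat n * x) * (of_nat m * y)"
    by (simp add: algebra_simps)
  also have "\<dots> \<in> R" by (rule mult_mem[OF *(2) *(4)])
  finally show "x * y \<in> K" using * by (intro KI[of "n * m"]) auto
qed (auto intro: R_subset_K)

lemma K_inverse: assumes "x \<in> K" shows "inverse x \<in> K"
proof (cases "x = 0")
  case False
  obtain n where n: "n > 0" "of_nat n * x \<in> R" using assms by (rule KE)
  obtain m where m: "m > 0" "of_nat m / (of_nat n * x) \<in> R"
    using algebraic_int_dvd_nat[OF field_subring_axioms algebraic_int_mem[OF n(2)] n(2)] n(1) False
    by auto
  have "of_nat m * inverse x = of_nat n * (of_nat m / (of_nat n * x))"
    using n by (simp add: field_simps)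
  also have "\<dots> \<in> R" using m by (intro mult_mem) auto
  finally show ?thesis using m by (intro KI)
qed auto

lemma K_divide: "x \<in> K \<Longrightarrow> y \<in> K \<Longrightarrow> x / y \<in> K"
  by (simp add: divide_inverse K.mult_mem K_inverse)

lemma of_rat_mem_K [simp]: "of_rat q \<in> K"
  by (cases q) (auto simp: of_rat_rat intro: K_divide)

definition bs :: "'a list"
  where "bs = (SOME bs. distinct bs \<and> set bs \<subseteq> R \<and> Q.independent (set bs) \<and> R \<subseteq> Q.span (set bs))"

lemma bs: "distinct bs" "set bs \<subseteq> R" "Q.independent (set bs)" "R \<subseteq> Q.span (set bs)"
proof -
  obtain B where B: "B \<subseteq> R" "Q.independent B" "R \<subseteq> Q.span B"
    using Q.maximal_independent_subset[of R] by auto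
  obtain F where F: "finite F" "R \<subseteq> Q.span F" using finite_rank by auto
  have "finite B" using Q.independent_span_bound[OF F(1) B(2)] B(1) F(2) by blast
  then obtain l where "set l = B" "distinct l" using finite_distinct_list by blast
  then have "\<exists>bs. distinct bs \<and> set bs \<subseteq> R \<and> Q.independent (set bs) \<and> R \<subseteq> Q.span (set bs)"
    using B by auto
  from someI_ex[OF this] show "distinct bs" "set bs \<subseteq> R" "Q.independent (set bs)" "R \<subseteq> Q.span (set bs)"
    unfolding bs_def by blast+
qed

definition d :: nat where "d = length bs"

abbreviation b :: "nat \<Rightarrow> 'a" where "b i \<equiv> bs ! i"

lemma b_mem: "i < d \<Longrightarrow> b i \<in> R"
  using bs(2) by (auto simp: d_def)

lemma K_subset_span: "x \<in> K \<Longrightarrow> x \<in> Q.span (set bs)"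
proof (elim KE)
  fix n :: nat assume "n > 0" "of_nat n * x \<in> R"
  then have "of_rat (inverse (of_nat n)) * (of_nat n * x) \<in> Q.span (set bs)"
    using bs(4) by (intro Q.span_scale) auto
  moreover have "of_rat (inverse (of_nat n)) * (of_nat n * x) = x"
    using \<open>n > 0\<close> by (simp add: of_rat_inverse)
  ultimately show ?thesis by simp
qed

definition coord :: "'a \<Rightarrow> nat \<Rightarrow> rat"
  where "coord x i = Q.representation (set bs) x (b i)"

lemma coord_diff: "x \<in> K \<Longrightarrow> y \<in> K \<Longrightarrow> coord (x - y) i = coord x i - coord y i"
  by (simp add: coord_def Q.representation_diff bs(3) K_subset_span)

lemma coord_scale: "x \<in> K \<Longrightarrow> coord (of_rat q * x) i = q * coord x i"
  by (simp add: coord_def Q.representation_scale bs(3) K_subset_span)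

lemma coord_sum: "(\<And>j. j \<in> I \<Longrightarrow> f j \<in> K) \<Longrightarrow> coord (sum f I) i = (\<Sum>j\<in>I. coord (f j) i)"
  by (simp add: coord_def Q.representation_sum bs(3) K_subset_span)

lemma coord_basis: "i < d \<Longrightarrow> j < d \<Longrightarrow> coord (b i) j = (if i = j then 1 else 0)"
  using Q.representation_basis[OF bs(3), of "b i"] bs(1)
  by (auto simp: coord_def d_def nth_eq_iff_index_eq)

lemma coord_expand: assumes "x \<in> K" shows "(\<Sum>i<d. of_rat (coord x i) * b i) = x"
proof -
  have "(\<Sum>i<d. of_rat (coord x i) * b i) =
      sum_list (map (\<lambda>v. of_rat (Q.representation (set bs) x v) * v) bs)"
    by (simp add: sum_list_sum_nth d_def lessThan_atLeast0 coord_def)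
  also have "\<dots> = (\<Sum>v\<in>set bs. of_rat (Q.representation (set bs) x v) * v)"
    by (rule sum_list_distinct_conv_sum_set[OF bs(1)])
  also have "\<dots> = x"
    using Q.sum_representation_eq[OF bs(3) K_subset_span[OF assms], of "set bs"] by simp
  finally show ?thesis .
qed

lemma coord_of_nat: "x \<in> K \<Longrightarrow> coord (of_nat n * x) i = of_nat n * coord x i"
  using coord_scale[of x "of_nat n" i] by simp

lemma coord_of_int: "x \<in> K \<Longrightarrow> coord (of_int n * x) i = of_int n * coord x i"
  using coord_scale[of x "of_int n" i] by simp

lemma coord_zero [simp]: "coord 0 i = 0"
  using coord_scale[of 0 0 i] by simp

lemma d_pos: "d > 0"
  using coord_expand[of 1] by (cases d) auto

lemma mem_if_integer_coords: 
  assumes "x \<in> K" "\<And>i. i < d \<Longrightarrow> coord x i \<in> \<int>" shows "x \<in> R"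
proof -
  have "of_rat (coord x i) * b i \<in> R" if "i < d" for i
    using assms(2)[OF that] b_mem[OF that] by (auto elim!: Ints_cases intro: mult_mem)
  then have "(\<Sum>i<d. of_rat (coord x i) * b i) \<in> R" by (intro sum_mem) auto
  then show ?thesis by (simp only: coord_expand[OF assms(1)])
qed

definition mulmat :: "'a \<Rightarrow> rat mat"
  where "mulmat x = mat d d (\<lambda>(i, j). coord (x * b i) j)"

lemma mulmat_carrier [simp]: "mulmat x \<in> carrier_mat d d"
  by (simp add: mulmat_def)

lemma mulmat_mult: assumes "x \<in> K" "y \<in> K" shows "mulmat (x * y) = mulmat x * mulmat y"
proof (rule eq_matI)
  fix i j assume ij: "i < dim_row (mulmat x * mulmat y)" "j < dim_col (mulmat x * mulmat y)"
  then have i: "i < d" and j: "j < d" by (auto simp: mulmat_def)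
  have K: "x * b i \<in> K" using assms i by (auto intro: K.mult_mem R_subset_K b_mem)
  have "x * y * b i = y * (x * b i)" by (simp add: mult_ac)
  also have "\<dots> = (\<Sum>k<d. of_rat (coord (x * b i) k) * (y * b k))"
    by (subst coord_expand[OF K, symmetric]) (simp add: sum_distrib_left mult_ac)
  finally have "coord (x * y * b i) j = coord (\<Sum>k<d. of_rat (coord (x * b i) k) * (y * b k)) j"
    by (rule arg_cong)
  also have "\<dots> = (\<Sum>k<d. coord (of_rat (coord (x * b i) k) * (y * b k)) j)"
    using assms by (intro coord_sum K.mult_mem R_subset_K[OF b_mem]) auto
  also have "\<dots> = (\<Sum>k<d. coord (x * b i) k * coord (y * b k) j)"
    using assms by (intro sum.cong refl coord_scale K.mult_mem R_subset_K[OF b_mem]) auto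
  finally have "coord (x * y * b i) j = (\<Sum>k<d. coord (x * b i) k * coord (y * b k) j)" .
  then show "mulmat (x * y) $$ (i, j) = (mulmat x * mulmat y) $$ (i, j)"
    using i j by (simp add: mulmat_def scalar_prod_def lessThan_atLeast0)
qed (auto simp: mulmat_def)

definition N :: "'a \<Rightarrow> rat" where "N x = det (mulmat x)"

lemma N_mult: "x \<in> K \<Longrightarrow> y \<in> K \<Longrightarrow> N (x * y) = N x * N y"
  by (simp add: N_def mulmat_mult det_mult[OF mulmat_carrier mulmat_carrier])

lemma N_one [simp]: "N 1 = 1"
proof -
  have "mulmat 1 = 1\<^sub>m d" by (rule eq_matI) (auto simp: mulmat_def coord_basis)
  then show ?thesis by (simp add: N_def)
qed

lemma N_power: "x \<in> K \<Longrightarrow> N (x ^ n) = N x ^ n"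
  by (induction n) (auto simp: N_mult K.power_mem)

lemma N_eq_0: assumes "x \<in> K" "N x = 0" shows "x = 0"
proof (rule ccontr)
  assume "x \<noteq> 0"
  then show False using N_mult[of x "inverse x"] assms K_inverse by simp
qed

lemma N_expand: "N x = (\<Sum>p | p permutes {0..<d}. signof p * (\<Prod>i=0..<d. coord (x * b i) (p i)))"
proof -
  have "p i < d" if "p permutes {0..<d}" "i < d" for p i
    using that permutes_in_image[OF that(1), of i] by simp
  then show ?thesis
    unfolding N_def by (subst det_def'[of _ d]) (auto simp: mulmat_def intro!: sum.cong prod.cong)
qed

lemma N_of_nat: "N (of_nat m) = of_nat m ^ d"
proof -
  have "mulmat (of_nat m) = of_nat m \<cdot>\<^sub>m 1\<^sub>m d"
    by (rule eq_matI) (auto simp: mulmat_def coord_of_nat coord_basis R_subset_K b_mem)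
  then show ?thesis by (simp add: N_def)
qed

text \<open>The determinant is homogeneous of degree \<open>d\<close> in the entries of the matrix.\<close>

lemma N_int_mem: 
  assumes k: "\<And>i j. i < d \<Longrightarrow> j < d \<Longrightarrow> of_nat k * coord (x * b i) j \<in> \<int>"
  shows "of_nat k ^ d * N x \<in> \<int>"
proof -
  have "of_nat k ^ d * N x = 
    (\<Sum>p | p permutes {0..<d}. signof p * (\<Prod>i=0..<d. of_nat k * coord (x * b i) (p i)))"
    by (simp add: N_expand sum_distrib_left prod.distrib mult_ac)
  also have "\<dots> \<in> \<int>"
  proof (intro Ints_sum Ints_mult[OF _ Ints_prod])
    fix p i assume "p \<in> {p. p permutes {0..<d}}" "i \<in> {0..<d}"
    then show "of_nat k * coord (x * b i) (p i) \<in> \<int>"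
      using permutes_in_image[of p "{0..<d}" i] by (intro k) auto
  qed (auto simp: sign_def)
  finally show ?thesis .
qed

text \<open>
  The powers of \<open>x\<close> act on the basis by matrices with a common denominator \<open>k\<close>. Hence the numbers
  \<open>k\<^sup>d N(x)\<^sup>n\<close> are all integers, so \<open>N x\<close> is one.
\<close>

lemma N_algebraic_int: assumes x: "x \<in> K" "algebraic_int x" shows "N x \<in> \<int>"
proof -
  obtain e where e: "\<And>V n. \<lbrakk>0 \<in> V; \<And>u v. u \<in> V \<Longrightarrow> v \<in> V \<Longrightarrow> u - v \<in> V;
      \<And>(k :: int) v. v \<in> V \<Longrightarrow> of_int k * v \<in> V; \<And>i. i < e \<Longrightarrow> x ^ i \<in> V\<rbrakk> \<Longrightarrow> x ^ n \<in> V"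
    using integral_power_mem[OF x(2)] by metis
  obtain k where k: "k > 0"
    "\<forall>t\<in>{..<e} \<times> {..<d} \<times> {..<d}. of_nat k * (case t of (l, i, j) \<Rightarrow> coord (x ^ l * b i) j) \<in> \<int>"
    using common_denominator[of "{..<e} \<times> {..<d} \<times> {..<d}"] by blast
  \<comment> \<open>\<open>V\<close> is the group of all elements that act on the basis with denominator \<open>k\<close>.\<close>
  define V where "V = {v \<in> K. \<forall>i<d. \<forall>j<d. of_nat k * coord (v * b i) j \<in> \<int>}"
  have V: "x ^ n \<in> V" for n
  proof (rule e)
    fix u v assume uv: "u \<in> V" "v \<in> V"
    then have "of_nat k * coord ((u - v) * b i) j = 
        of_nat k * coord (u * b i) j - of_nat k * coord (v * b i) j" if "i < d" for i j
      using that by (simp add: V_def left_diff_distrib coord_diff K.mult_mem R_subset_K b_mem right_diff_distrib)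
    then show "u - v \<in> V" using uv by (auto simp: V_def K.diff_mem)
  next
    fix v and m :: int assume v: "v \<in> V"
    then have *: "of_nat k * coord (of_int m * v * b i) j = of_int m * (of_nat k * coord (v * b i) j)"
      if "i < d" for i j
      using that coord_of_int[of "v * b i" m j]
      by (simp add: V_def K.mult_mem R_subset_K b_mem mult.assoc)
    have "of_nat k * coord (of_int m * v * b i) j \<in> \<int>" if "i < d" "j < d" for i j
      unfolding *[OF that(1)] using v that by (intro Ints_mult[OF Ints_of_int]) (auto simp: V_def)
    then show "of_int m * v \<in> V" using v by (auto simp: V_def K.mult_mem)
  qed (use k(2) x(1) in \<open>auto simp: V_def K.power_mem\<close>)
  have "of_nat (k ^ d) * N x ^ n \<in> \<int>" for n
    using N_int_mem[of k "x ^ n"] V[of n] N_power[OF x(1)] by (auto simp: V_def)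
  then show ?thesis by (rule power_bounded_denom_int[rotated]) (use k(1) in simp)
qed

section \<open>The complete integral closure\<close>

text \<open>
  This is the ring of integers of \<open>K\<close>. In place of a monic equation, integrality is expressed by a
  common denominator of all powers: with this form the ring axioms are immediate, and it is what the
  boundary map and the norm need.
\<close>

definition S :: "'a set"
  where "S = {x. \<exists>m>0. \<forall>n. of_nat m * x ^ n \<in> R}"

lemma SI: "m > 0 \<Longrightarrow> (\<And>n. of_nat m * x ^ n \<in> R) \<Longrightarrow> x \<in> S"
  by (auto simp: S_def)

lemma SE: assumes "x \<in> S" obtains m where "m > 0" "\<And>n. of_nat m * x ^ n \<in> R"
  using assms by (auto simp: S_def)

lemma S_subset_K: "x \<in> S \<Longrightarrow> x \<in> K"
  by (metis SE KI power_one_right)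

lemma R_subset_S: "x \<in> R \<Longrightarrow> x \<in> S"
  by (rule SI[of 1]) (auto intro: mem)

sublocale S: field_subring S
proof
  fix x y assume "x \<in> S" "y \<in> S"
  then obtain k l where *: "k > 0" "\<And>n. of_nat k * x ^ n \<in> R" "l > 0" "\<And>n. of_nat l * y ^ n \<in> R"
    by (metis SE)
  have "of_nat (k * l) * (x * y) ^ n = (of_nat k * x ^ n) * (of_nat l * y ^ n)" for n
    by (simp add: algebra_simps)
  also have "\<dots>n \<in> R" for n by (rule mult_mem[OF *(2) *(4)])
  finally show "x * y \<in> S" using * by (intro SI[of "k * l"]) (auto simp del: of_nat_mult)
  have "of_nat (k * l) * (x - y) ^ n = 
    (\<Sum>i\<le>n. of_int (int (n choose i) * (- 1) ^ (n - i)) * ((of_nat k * x ^ i) * (of_nat l * y ^ (n - i))))" for n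
    using binomial_ring[of x "- y" n]
    by (simp add: sum_distrib_left power_minus[of y] mult_ac)
  also have "\<dots>n \<in> R" for n by (intro sum_mem mult_mem[OF of_int_mem mult_mem[OF *(2) *(4)]])
  finally show "x - y \<in> S" using * by (intro SI[of "k * l"]) (auto simp del: of_nat_mult)
qed (auto intro: R_subset_S)

lemma algebraic_int_mem_S: assumes x: "x \<in> K" "algebraic_int x" shows "x \<in> S"
proof -
  obtain e where e: "\<And>V n. \<lbrakk>0 \<in> V; \<And>u v. u \<in> V \<Longrightarrow> v \<in> V \<Longrightarrow> u - v \<in> V;
      \<And>(k :: int) v. v \<in> V \<Longrightarrow> of_int k * v \<in> V; \<And>i. i < e \<Longrightarrow> x ^ i \<in> V\<rbrakk> \<Longrightarrow> x ^ n \<in> V"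
    using integral_power_mem[OF x(2)] by metis
  obtain k where k: "k > 0" "of_nat k * x \<in> R" using x(1) by (rule KE)
  have *: "of_nat k ^ e * x ^ i \<in> R" if "i < e" for i
  proof -
    have "of_nat k ^ e * x ^ i = of_nat (k ^ (e - i)) * (of_nat k * x) ^ i"
      using that by (simp add: power_mult_distrib flip: power_add mult.assoc)
    also have "\<dots> \<in> R" by (rule mult_mem[OF of_nat_mem power_mem[OF k(2)]])
    finally show ?thesis .
  qed
  have "x ^ n \<in> {v. of_nat k ^ e * v \<in> R}" for n
  proof (rule e)
    fix v and m :: int assume "v \<in> {v. of_nat k ^ e * v \<in> R}"
    then show "of_int m * v \<in> {v. of_nat k ^ e * v \<in> R}"
      using mult_mem[of "of_int m" "of_nat k ^ e * v"] by (simp add: mult_ac)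
  qed (auto simp: right_diff_distrib diff_mem *)
  then show ?thesis using k(1) by (intro SI[of "k ^ e"]) auto
qed

lemma S_completely_closed:
  assumes "a \<in> K" "a \<noteq> 0" "m > 0" "\<And>n. of_nat m * (a * q ^ n) \<in> R"
  shows "q \<in> S"
proof -
  obtain k where k: "k > 0" "of_nat k * inverse a \<in> R"
    using K_inverse[OF assms(1)] by (rule KE)
  have "of_nat (k * m) * q ^ n = (of_nat k * inverse a) * (of_nat m * (a * q ^ n))" for n
    using assms(2) by (simp add: field_simps)
  also have "\<dots>n \<in> R" for n by (rule mult_mem[OF k(2) assms(4)])
  finally show ?thesis using k(1) assms(3) by (intro SI[of "k * m"]) (auto simp del: of_nat_mult)
qed

text \<open>
  If \<open>m x\<^sup>n \<in> R\<close> for all \<open>n\<close>, then \<open>m\<^sup>d N(x)\<^sup>n = N (m x\<^sup>n)\<close> is the norm of an algebraic integer.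
\<close>

lemma N_int: assumes "x \<in> S" shows "N x \<in> \<int>"
proof -
  obtain m where m: "m > 0" "\<And>n. of_nat m * x ^ n \<in> R"
    using assms by (metis SE)
  have K: "x \<in> K" using assms by (rule S_subset_K)
  have "of_nat (m ^ d) * N x ^ n = N (of_nat m * x ^ n)" for n
    using K by (simp add: N_mult N_of_nat N_power K.power_mem)
  also have "\<dots>n \<in> \<int>" for n
    using m by (intro N_algebraic_int algebraic_int_mem R_subset_K) auto
  finally show ?thesis by (rule power_bounded_denom_int[rotated]) (use m(1) in simp)
qed

section \<open>Approximation in norm and its finiteness consequences\<close>

definition lattice :: "'a set"
  where "lattice = {x \<in> K. \<forall>i<d. coord x i \<in> \<int>}"

lemma lattice_subset_R: "x \<in> lattice \<Longrightarrow> x \<in> R"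
  by (auto simp: lattice_def intro: mem_if_integer_coords)

text \<open>The norm is a homogeneous form of degree \<open>d \<ge> 1\<close> in the coordinates.\<close>

lemma N_small:
  obtains Q :: nat where "Q > 0"
    "\<And>x. \<lbrakk>x \<in> K; \<And>i. i < d \<Longrightarrow> \<bar>coord x i\<bar> < 1 / of_nat Q\<rbrakk> \<Longrightarrow> \<bar>N x\<bar> < 1"
proof -
  \<comment> \<open>A common bound for the structure constants of the multiplication.\<close>
  define G where "G = (\<Sum>l<d. \<Sum>i<d. \<Sum>j<d. \<bar>coord (b l * b i) j\<bar>)"
  have G: "\<bar>coord (b l * b i) j\<bar> \<le> G" if "l < d" "i < d" "j < d" for l i j
  proof -
    have "\<bar>coord (b l * b i) j\<bar> \<le> (\<Sum>j<d. \<bar>coord (b l * b i) j\<bar>)"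
      using that by (intro member_le_sum[of j "{..<d}" "\<lambda>j. \<bar>coord (b l * b i) j\<bar>"]) auto
    also have "\<dots> \<le> (\<Sum>i<d. \<Sum>j<d. \<bar>coord (b l * b i) j\<bar>)"
      using that by (intro member_le_sum[of i "{..<d}" "\<lambda>i. \<Sum>j<d. \<bar>coord (b l * b i) j\<bar>"]) (auto intro: sum_nonneg)
    also have "\<dots> \<le> G"
      unfolding G_def using that
      by (intro member_le_sum[of l "{..<d}" "\<lambda>l. \<Sum>i<d. \<Sum>j<d. \<bar>coord (b l * b i) j\<bar>"]) (auto intro: sum_nonneg)
    finally show ?thesis .
  qed
  have "G \<ge> 0" unfolding G_def by (intro sum_nonneg) auto
  define E where "E = of_nat d * G"
  have "E \<ge> 0" using \<open>G \<ge> 0\<close> by (simp add: E_def)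
  obtain Q :: nat where Q: "of_nat Q > fact d * E + 1"
    using reals_Archimedean2 by blast
  have "1 \<le> (fact d :: rat)" by (rule fact_ge_1)
  then have "E \<le> fact d * E" using \<open>E \<ge> 0\<close> mult_right_mono[of 1 "fact d" E] by simp
  have Q1: "(of_nat Q :: rat) > 1" using Q \<open>E \<ge> 0\<close> \<open>E \<le> fact d * E\<close> by linarith
  have E1: "E / of_nat Q \<le> 1" using Q Q1 \<open>E \<le> fact d * E\<close> by (simp add: field_simps)
  have E2: "fact d * (E / of_nat Q) < 1" using Q Q1 by (simp add: field_simps)
  have "\<bar>N x\<bar> < 1" if x: "x \<in> K" and small: "\<And>i. i < d \<Longrightarrow> \<bar>coord x i\<bar> < 1 / of_nat Q" for x
  proof -
    have entry: "\<bar>coord (x * b i) j\<bar> \<le> E / of_nat Q" if "i < d" "j < d" for i j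
    proof -
      have "x * b i = (\<Sum>l<d. of_rat (coord x l) * (b l * b i))"
        by (subst coord_expand[OF x, symmetric], subst sum_distrib_right) (simp add: mult_ac)
      then have "coord (x * b i) j = coord (\<Sum>l<d. of_rat (coord x l) * (b l * b i)) j"
        by (rule arg_cong)
      also have "\<dots> = (\<Sum>l<d. coord (of_rat (coord x l) * (b l * b i)) j)"
        using that by (intro coord_sum K.mult_mem R_subset_K[OF b_mem]) auto
      also have "\<dots> = (\<Sum>l<d. coord x l * coord (b l * b i) j)"
        using that by (intro sum.cong refl coord_scale K.mult_mem R_subset_K[OF b_mem]) auto
      also have "\<bar>\<dots>\<bar> \<le> (\<Sum>l<d. \<bar>coord x l * coord (b l * b i) j\<bar>)"
        by (rule sum_abs)
      also have "\<dots> \<le> (\<Sum>l<d. 1 / of_nat Q * G)"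
        unfolding abs_mult using that G small
        by (intro sum_mono mult_mono) (auto intro: less_imp_le)
      also have "\<dots> = E / of_nat Q" by (simp add: E_def)
      finally show ?thesis .
    qed
    have "\<bar>N x\<bar> \<le> (\<Sum>p | p permutes {0..<d}. \<bar>signof p * (\<Prod>i=0..<d. coord (x * b i) (p i))\<bar>)"
      unfolding N_expand by (rule sum_abs)
    also have "\<dots> \<le> (\<Sum>p | p permutes {0..<d}. (E / of_nat Q) ^ d)"
    proof (intro sum_mono)
      fix p assume "p \<in> {p. p permutes {0..<d}}"
      then have "p i < d" if "i < d" for i
        using permutes_in_image[of p "{0..<d}" i] that by auto
      then have "(\<Prod>i=0..<d. \<bar>coord (x * b i) (p i)\<bar>) \<le> (\<Prod>i=0..<d. E / of_nat Q)"
        using entry by (intro prod_mono) auto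
      then show "\<bar>signof p * (\<Prod>i=0..<d. coord (x * b i) (p i))\<bar> \<le> (E / of_nat Q) ^ d"
        by (simp add: abs_mult abs_prod sign_def)
    qed
    also have "\<dots> = fact d * (E / of_nat Q) ^ d"
      using card_permutations[of "{0..<d}" d] by simp
    also have "\<dots> \<le> fact d * (E / of_nat Q) ^ 1"
      using d_pos E1 \<open>E \<ge> 0\<close> by (intro mult_left_mono power_decreasing) auto
    also have "\<dots> < 1" using E2 by simp
    finally show ?thesis .
  qed
  moreover have "Q > 0" using Q1 by (cases Q) auto
  ultimately show ?thesis using that by blast
qed

text \<open>
  Pigeonhole principle (Dirichlet, Hurwitz): cut the unit cube into \<open>Q\<^sup>d\<close> small cubes. Among the
  fractional parts of the coordinate vectors of the \<open>Q\<^sup>d + 1\<close> elements \<open>0, x, \<dots>, Q\<^sup>d x\<close>, two lie in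
  the same small cube, and the difference of these two multiples is close to a lattice point.
\<close>

lemma norm_approximation:
  obtains M :: nat where "M > 0"
    "\<And>x. x \<in> K \<Longrightarrow> \<exists>m\<in>{1..M}. \<exists>r\<in>lattice. \<bar>N (of_nat m * x - r)\<bar> < 1"
proof -
  obtain Q :: nat where Q: "Q > 0"
    "\<And>x. \<lbrakk>x \<in> K; \<And>i. i < d \<Longrightarrow> \<bar>coord x i\<bar> < 1 / of_nat Q\<rbrakk> \<Longrightarrow> \<bar>N x\<bar> < 1"
    by (metis N_small)
  define M where "M = Q ^ d"
  have "\<exists>m\<in>{1..M}. \<exists>r\<in>lattice. \<bar>N (of_nat m * x - r)\<bar> < 1" if x: "x \<in> K" for x
  proof -
    define fl :: "nat \<Rightarrow> nat \<Rightarrow> int" where "fl = (\<lambda>m i. \<lfloor>of_nat m * coord x i\<rfloor>)"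
    define fr :: "nat \<Rightarrow> nat \<Rightarrow> rat" where "fr = (\<lambda>m i. frac (of_nat m * coord x i))"
    define box where "box = (\<lambda>m. restrict (\<lambda>i. nat \<lfloor>of_nat Q * fr m i\<rfloor>) {..<d})"
    have fr: "0 \<le> fr m i" "fr m i < 1" for m i by (auto simp: fr_def frac_lt_1)
    have "nat \<lfloor>of_nat Q * fr m i\<rfloor> < Q" for m i
      using fr[of m i] Q(1) by (simp add: nat_less_iff floor_less_iff)
    then have "box ` {0..M} \<subseteq> {..<d} \<rightarrow>\<^sub>E {..<Q}" by (auto simp: box_def split: if_splits)
    moreover have fin: "finite ({..<d} \<rightarrow>\<^sub>E {..<Q})" by (intro finite_PiE) auto
    moreover have "card ({..<d} \<rightarrow>\<^sub>E {..<Q}) < card {0..M}" by (simp add: card_PiE M_def)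
    ultimately have "\<not> inj_on box {0..M}"
      using card_mono[OF fin] by (metis card_image not_le)
    then obtain k l where kl: "k < l" "l \<le> M" "box k = box l"
      by (metis (no_types, lifting) inj_onI atLeastAtMost_iff nat_neq_iff)
    define r where "r = (\<Sum>i<d. of_int (fl l i - fl k i) * b i)"
    have rK: "r \<in> K" unfolding r_def by (intro K.sum_mem K.mult_mem[OF K.of_int_mem] R_subset_K[OF b_mem]) auto
    have coord_r: "coord r i = of_int (fl l i - fl k i)" if "i < d" for i
    proof -
      have "coord r i = (\<Sum>j<d. coord (of_int (fl l j - fl k j) * b j) i)"
        unfolding r_def by (intro coord_sum K.mult_mem[OF K.of_int_mem] R_subset_K[OF b_mem]) auto
      also have "\<dots> = (\<Sum>j<d. of_int (fl l j - fl k j) * coord (b j) i)"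
        by (intro sum.cong refl coord_of_int R_subset_K b_mem) auto
      also have "\<dots> = (\<Sum>j<d. if i = j then of_int (fl l j - fl k j) else 0)"
        using that by (intro sum.cong) (auto simp: coord_basis)
      finally show ?thesis using that by simp
    qed
    have "\<bar>N (of_nat (l - k) * x - r)\<bar> < 1"
    proof (rule Q(2))
      fix i assume i: "i < d"
      have "coord (of_nat (l - k) * x - r) i = of_nat (l - k) * coord x i - of_int (fl l i - fl k i)"
        using x rK i by (simp add: coord_diff coord_of_nat coord_r K.mult_mem del: of_int_diff)
      also have "\<dots> = fr l i - fr k i"
        using kl(1) by (simp add: fl_def fr_def frac_def of_nat_diff algebra_simps)
      finally have *: "coord (of_nat (l - k) * x - r) i = fr l i - fr k i" .
      have "nat \<lfloor>of_nat Q * fr k i\<rfloor> = nat \<lfloor>of_nat Q * fr l i\<rfloor>"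
        using fun_cong[OF kl(3), of i] i by (simp add: box_def)
      then have "\<lfloor>of_nat Q * fr k i\<rfloor> = \<lfloor>of_nat Q * fr l i\<rfloor>"
        using fr by (simp add: eq_nat_nat_iff)
      then have "\<bar>of_nat Q * fr l i - of_nat Q * fr k i\<bar> < 1"
        by linarith
      then have "of_nat Q * \<bar>fr l i - fr k i\<bar> < 1"
        by (simp add: right_diff_distrib[symmetric] abs_mult)
      then show "\<bar>coord (of_nat (l - k) * x - r) i\<bar> < 1 / of_nat Q"
        unfolding * using Q(1) by (simp add: field_simps)
    qed (use x rK in \<open>auto intro!: K.mem\<close>)
    moreover have "r \<in> lattice" using rK coord_r by (auto simp: lattice_def)
    ultimately show ?thesis using kl by (intro bexI[of _ "l - k"] bexI[of _ r]) auto
  qed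
  then show ?thesis using that[of M] Q(1) by (simp add: M_def)
qed

lemma N_less_1: "x \<in> S \<Longrightarrow> \<bar>N x\<bar> < 1 \<Longrightarrow> x = 0"
  using N_int[of x] N_eq_0[OF S_subset_K, of x] by (auto elim!: Ints_cases)

text \<open>
  Approximating \<open>x \<in> S\<close> leaves a difference \<open>m x - r\<close> in \<open>S\<close> of norm less than \<open>1\<close>, and norms of
  elements of \<open>S\<close> are integers. So \<open>m x\<close> itself is a lattice point.
\<close>

lemma S_in_lattice:
  obtains c :: nat where "c > 0" "\<And>x. x \<in> S \<Longrightarrow> of_nat c * x \<in> lattice"
proof -
  obtain M :: nat where M: "M > 0"
    "\<And>x. x \<in> K \<Longrightarrow> \<exists>m\<in>{1..M}. \<exists>r\<in>lattice. \<bar>N (of_nat m * x - r)\<bar> < 1"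
    by (metis norm_approximation)
  have "of_nat (fact M) * x \<in> lattice" if x: "x \<in> S" for x
  proof -
    obtain m r where m: "m \<in> {1..M}" "r \<in> lattice" "\<bar>N (of_nat m * x - r)\<bar> < 1"
      using M(2)[OF S_subset_K[OF x]] by auto
    have "of_nat m * x - r = 0"
      by (intro N_less_1[OF _ m(3)] S.diff_mem[OF S.mult_mem[OF S.of_nat_mem x]]
          R_subset_S[OF lattice_subset_R[OF m(2)]])
    then have r: "r = of_nat m * x" by simp
    obtain k where k: "fact M = m * k" using m(1) dvd_fact[of m M] by (auto elim: dvdE)
    have "of_nat (fact M) * x = of_nat k * r" unfolding k r by (simp add: mult_ac)
    also have "\<dots> \<in> lattice" using m(2) by (auto simp: lattice_def coord_of_nat K.mult_mem)
    finally show ?thesis .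
  qed
  then show ?thesis using that[of "fact M"] by simp
qed

lemma conductor:
  obtains c :: nat where "c > 0" "\<And>x. x \<in> S \<Longrightarrow> of_nat c * x \<in> R"
  using S_in_lattice lattice_subset_R by metis

text \<open>
  \<open>S / n S\<close> is finite, as \<open>c S\<close> lies in a lattice that is contained in \<open>S\<close>: coordinates modulo \<open>n c\<close>
  determine the residue class. The residue ring is represented by an invariant with finite range.
\<close>

lemma finite_residues:
  assumes n: "n > 0"
  obtains f :: "'a \<Rightarrow> nat \<Rightarrow> int" where "finite (f ` S)"
    "\<And>x y. \<lbrakk>x \<in> S; y \<in> S; f x = f y\<rbrakk> \<Longrightarrow> (x - y) / of_nat n \<in> S"
proof -
  obtain c :: nat where c: "c > 0" "\<And>x. x \<in> S \<Longrightarrow> of_nat c * x \<in> lattice"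
    by (metis S_in_lattice)
  define f :: "'a \<Rightarrow> nat \<Rightarrow> int"
    where "f = (\<lambda>x. restrict (\<lambda>i. \<lfloor>coord (of_nat c * x) i\<rfloor> mod (int n * int c)) {..<d})"
  have "f ` S \<subseteq> {..<d} \<rightarrow>\<^sub>E {0..<int n * int c}"
    using n c(1) by (auto simp: f_def split: if_splits)
  moreover have "finite ({..<d} \<rightarrow>\<^sub>E {0..<int n * int c})" by (intro finite_PiE) auto
  ultimately have "finite (f ` S)" by (rule finite_subset)
  moreover have "(x - y) / of_nat n \<in> S" if x: "x \<in> S" and y: "y \<in> S" and eq: "f x = f y" for x y
  proof -
    have K: "(x - y) / of_nat n \<in> K"
      using x y by (intro K_divide K.diff_mem S_subset_K) auto
    have "coord ((x - y) / of_nat n) i \<in> \<int>" if i: "i < d" for i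
    proof -
      obtain k l where kl: "coord (of_nat c * x) i = of_int k" "coord (of_nat c * y) i = of_int l"
        using c(2)[OF x] c(2)[OF y] i unfolding lattice_def by (metis (mono_tags, lifting) Ints_cases mem_Collect_eq)
      have "k mod (int n * int c) = l mod (int n * int c)"
        using fun_cong[OF eq, of i] i by (simp add: f_def kl)
      then obtain t where t: "k - l = int n * int c * t"
        by (metis mod_eq_dvd_iff dvdE)
      have "of_nat n * of_nat c * coord ((x - y) / of_nat n) i =
          coord (of_nat (n * c) * ((x - y) / of_nat n)) i"
        using K coord_of_nat[of "(x - y) / of_nat n" "n * c" i] by simp
      also have "of_nat (n * c) * ((x - y) / of_nat n) = of_nat c * x - of_nat c * y"
        using n by (simp add: field_simps)
      also have "coord (of_nat c * x - of_nat c * y) i = of_int (k - l)"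
        using x y by (simp add: coord_diff K.mult_mem S_subset_K kl)
      also have "\<dots> = of_nat n * of_nat c * of_int t" unfolding t by simp
      finally show ?thesis using n c(1) by simp
    qed
    with K show ?thesis by (auto intro!: R_subset_S mem_if_integer_coords)
  qed
  ultimately show ?thesis using that by blast
qed

definition S_ideal :: "'a set \<Rightarrow> bool"
  where "S_ideal U \<longleftrightarrow> U \<subseteq> S \<and> (\<exists>u\<in>U. u \<noteq> 0) \<and> (\<forall>u\<in>U. \<forall>v\<in>U. u - v \<in> U) \<and> (\<forall>s\<in>S. \<forall>u\<in>U. s * u \<in> U)"

text \<open>
  If \<open>a\<close> is a nonzero element of least norm in \<open>U\<close> and \<open>u \<in> U\<close>, then approximating \<open>u / a\<close> gives an
  element \<open>m u - r a\<close> of \<open>U\<close> of smaller norm, which must vanish. So \<open>a\<close> divides \<open>m u\<close>.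
\<close>

lemma ideal_almost_principal:
  obtains M :: nat where "M > 0"
    "\<And>U. S_ideal U \<Longrightarrow> \<exists>a\<in>U. a \<noteq> 0 \<and> (\<forall>u\<in>U. of_nat M * u / a \<in> S)"
proof -
  obtain M :: nat where M: "M > 0"
    "\<And>x. x \<in> K \<Longrightarrow> \<exists>m\<in>{1..M}. \<exists>r\<in>lattice. \<bar>N (of_nat m * x - r)\<bar> < 1"
    by (metis norm_approximation)
  have "\<exists>a\<in>U. a \<noteq> 0 \<and> (\<forall>u\<in>U. of_nat (fact M) * u / a \<in> S)" if U: "S_ideal U" for U
  proof -
    have US: "u \<in> S" if "u \<in> U" for u using U that by (auto simp: S_ideal_def)
    obtain u0 where "u0 \<in> U" "u0 \<noteq> 0" using U by (auto simp: S_ideal_def)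
    then obtain a where a: "a \<in> U" "a \<noteq> 0"
      and min: "\<And>u. u \<in> U \<Longrightarrow> u \<noteq> 0 \<Longrightarrow> nat \<lfloor>\<bar>N a\<bar>\<rfloor> \<le> nat \<lfloor>\<bar>N u\<bar>\<rfloor>"
      using ex_has_least_nat[of "\<lambda>u. u \<in> U \<and> u \<noteq> 0" u0 "\<lambda>u. nat \<lfloor>\<bar>N u\<bar>\<rfloor>"] by metis
    have "of_nat (fact M) * u / a \<in> S" if u: "u \<in> U" for u
    proof -
      have K: "u / a \<in> K" using u a US by (intro K_divide S_subset_K) auto
      obtain m r where m: "m \<in> {1..M}" "r \<in> lattice" "\<bar>N (of_nat m * (u / a) - r)\<bar> < 1"
        using M(2)[OF K] by auto
      have rS: "r \<in> S" using m(2) by (intro R_subset_S lattice_subset_R)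
      define v where "v = of_nat m * u - r * a"
      have v: "v \<in> U" unfolding v_def using U u a rS by (auto simp: S_ideal_def)
      have "v = (of_nat m * (u / a) - r) * a" using a(2) by (simp add: v_def field_simps)
      then have "N v = N (of_nat m * (u / a) - r) * N a"
        using K rS US[OF a(1)] by (simp only: N_mult K.diff_mem K.mult_mem S_subset_K K.of_nat_mem)
      moreover have Na: "N a \<noteq> 0" using N_eq_0[of a] a US S_subset_K by blast
      ultimately have "\<bar>N v\<bar> < \<bar>N a\<bar>"
        using m(3) mult_strict_right_mono[OF m(3), of "\<bar>N a\<bar>"] by (simp add: abs_mult)
      moreover have "N v \<in> \<int>" "N a \<in> \<int>" using v a US N_int by auto
      then obtain p q where "N v = of_int p" "N a = of_int q" by (auto elim!: Ints_cases)
      ultimately have "nat \<lfloor>\<bar>N v\<bar>\<rfloor> < nat \<lfloor>\<bar>N a\<bar>\<rfloor>" using Na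
        by (simp flip: of_int_abs) 
      then have "v = 0" using min[OF v] by linarith
      then have r: "of_nat m * u / a = r" using a(2) by (simp add: v_def field_simps)
      obtain k where k: "fact M = m * k" using m(1) dvd_fact[of m M] by (auto elim: dvdE)
      have "of_nat (fact M) * u / a = of_nat k * (of_nat m * u / a)" unfolding k by (simp add: mult_ac)
      also have "\<dots> \<in> S" unfolding r using rS by (intro S.mult_mem) auto
      finally show ?thesis .
    qed
    with a show ?thesis by blast
  qed
  then show ?thesis using that[of "fact M"] by simp
qed

text \<open>
  Each ideal \<open>U n\<close> is up to scaling an ideal \<open>V n\<close> between \<open>M S\<close> and \<open>S\<close>, and there are only finitely
  many of those, as \<open>S / M S\<close> is finite.
\<close>

lemma ideal_classes_finite:
  fixes U :: "nat \<Rightarrow> 'a set"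
  assumes U: "\<And>n. S_ideal (U n)"
  obtains i j q where "i < j" "q \<in> K" "q \<noteq> 0" "U j = (\<lambda>u. q * u) ` U i"
proof -
  obtain M :: nat where M: "M > 0"
    "\<And>U. S_ideal U \<Longrightarrow> \<exists>a\<in>U. a \<noteq> 0 \<and> (\<forall>u\<in>U. of_nat M * u / a \<in> S)"
    by (metis ideal_almost_principal)
  obtain a where a: "\<And>n. a n \<in> U n" "\<And>n. a n \<noteq> 0" "\<And>n u. u \<in> U n \<Longrightarrow> of_nat M * u / a n \<in> S"
    using M(2)[OF U] by metis
  define V where "V = (\<lambda>n. (\<lambda>u. of_nat M * u / a n) ` U n)"
  have VS: "v \<in> S" if "v \<in> V n" for v n using that a(3) by (auto simp: V_def)
  obtain f :: "'a \<Rightarrow> nat \<Rightarrow> int" where f: "finite (f ` S)"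
    "\<And>x y. \<lbrakk>x \<in> S; y \<in> S; f x = f y\<rbrakk> \<Longrightarrow> (x - y) / of_nat M \<in> S"
    using finite_residues[OF M(1)] by metis
  have "finite (range (\<lambda>n. f ` V n))"
    by (rule finite_subset[of _ "Pow (f ` S)"]) (use VS f(1) in auto)
  then obtain i j where ij: "i < j" "f ` V i = f ` V j"
    by (metis (no_types, lifting) finite_imageD infinite_UNIV_nat injI nat_neq_iff)
  have sub: "V k \<subseteq> V l" if eq: "f ` V k = f ` V l" for k l
  proof
    fix v assume v: "v \<in> V k"
    then obtain w where w: "w \<in> V l" "f v = f w" using eq by blast
    then obtain u where u: "u \<in> U l" "w = of_nat M * u / a l" by (auto simp: V_def)
    define s where "s = (v - w) / of_nat M"
    have s: "s \<in> S" unfolding s_def using v w VS f(2) by blast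
    have "v = w + of_nat M * s" using M(1) by (simp add: s_def)
    also have "\<dots> = of_nat M * (u - (- s) * a l) / a l"
      using u(2) a(2)[of l] by (simp add: field_simps)
    finally have v: "v = of_nat M * (u - (- s) * a l) / a l" .
    have "u - (- s) * a l \<in> U l"
      using U[of l] u(1) a(1)[of l] S.uminus_mem[OF s] unfolding S_ideal_def by blast
    with v show "v \<in> V l" by (auto simp: V_def)
  qed
  have V: "V i = V j" using sub ij(2) by blast
  define q where "q = a j / a i"
  have "a n \<in> K" for n using a(1)[of n] U[of n] S_subset_K by (auto simp: S_ideal_def)
  then have "q \<in> K" by (auto simp: q_def intro: K_divide)
  moreover have "q \<noteq> 0" using a(2) by (simp add: q_def)
  moreover have "U j = (\<lambda>u. q * u) ` U i"
  proof (intro equalityI subsetI)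
    fix u assume "u \<in> U j"
    then have "of_nat M * u / a j \<in> V i" unfolding V by (auto simp: V_def)
    then obtain w where "w \<in> U i" "of_nat M * u / a j = of_nat M * w / a i" by (auto simp: V_def)
    then show "u \<in> (\<lambda>u. q * u) ` U i"
      using M(1) a(2) by (intro image_eqI[of _ _ w]) (auto simp: q_def field_simps)
  next
    fix u assume "u \<in> (\<lambda>u. q * u) ` U i"
    then obtain w where w: "w \<in> U i" "u = q * w" by auto
    then have "of_nat M * w / a i \<in> V j" unfolding V[symmetric] by (auto simp: V_def)
    then obtain u' where "u' \<in> U j" "of_nat M * w / a i = of_nat M * u' / a j" by (auto simp: V_def)
    moreover from this have "u' = u"
      using M(1) a(2)[of i] a(2)[of j] w by (auto simp: q_def field_simps)
    ultimately show "u \<in> U j" by simp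
  qed
  ultimately show ?thesis using ij(1) that by blast
qed

section \<open>Idempotents modulo the conductor and comaximal elements\<close>

lemma divides_nat:
  assumes "x \<in> S"
  obtains n :: nat where "n > 0" "of_nat n / x \<in> S"
proof -
  obtain n where "n > 0" "of_nat n * inverse x \<in> R"
    using K_inverse[OF S_subset_K[OF assms]] by (rule KE)
  then show ?thesis using that[of n] R_subset_S by (simp add: divide_inverse)
qed

definition multiples :: "nat \<Rightarrow> 'a set"
  where "multiples c = {x. x / of_nat c \<in> S}"

lemma multiples_add: "x \<in> multiples c \<Longrightarrow> y \<in> multiples c \<Longrightarrow> x + y \<in> multiples c"
  by (simp add: multiples_def add_divide_distrib S.add_mem)

lemma multiples_diff: "x \<in> multiples c \<Longrightarrow> y \<in> multiples c \<Longrightarrow> x - y \<in> multiples c"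
  by (simp add: multiples_def diff_divide_distrib S.diff_mem)

lemma multiples_mult: "x \<in> multiples c \<Longrightarrow> y \<in> S \<Longrightarrow> x * y \<in> multiples c"
  using S.mult_mem[of "x / of_nat c" y] by (simp add: multiples_def)

lemma multiples_uminus: "x \<in> multiples c \<Longrightarrow> - x \<in> multiples c"
  by (simp add: multiples_def S.uminus_mem)

lemma multiples_zero [simp]: "0 \<in> multiples c"
  by (simp add: multiples_def)

lemma multiples_power_diff:
  assumes "x * x - x \<in> multiples c" "x \<in> S" "n > 0"
  shows "x ^ n - x \<in> multiples c"
  using assms(3)
proof (induction n rule: nat_induct_non_zero)
  case (Suc n)
  have "x ^ Suc n - x = (x ^ n - x) * x + (x * x - x)" by (simp add: algebra_simps)
  also have "\<dots> \<in> multiples c" using Suc assms by (intro multiples_add multiples_mult) auto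
  finally show ?case .
qed simp

text \<open>
  In the finite ring \<open>S / c S\<close> the powers of \<open>y\<close> are eventually periodic with some period \<open>p\<close>. The
  power with an exponent that is a large multiple of \<open>p\<close> is idempotent.
\<close>

lemma idempotent_power:
  assumes "c > 0" "y \<in> S"
  obtains n where "n > 0" "y ^ n * y ^ n - y ^ n \<in> multiples c"
proof -
  obtain f :: "'a \<Rightarrow> nat \<Rightarrow> int" where f: "finite (f ` S)"
    "\<And>x y. \<lbrakk>x \<in> S; y \<in> S; f x = f y\<rbrakk> \<Longrightarrow> (x - y) / of_nat c \<in> S"
    using finite_residues[OF assms(1)] by metis
  have "finite (range (\<lambda>n. f (y ^ n)))"
    by (rule finite_subset[OF _ f(1)]) (use assms(2) S.power_mem in auto)
  then obtain i j where ij: "i < j" "f (y ^ i) = f (y ^ j)"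
    by (metis (no_types, lifting) finite_imageD infinite_UNIV_nat injI nat_neq_iff)
  define p where "p = j - i"
  have p: "p > 0" using ij(1) by (simp add: p_def)
  have step: "y ^ (i + p) - y ^ i \<in> multiples c"
    using f(2)[of "y ^ j" "y ^ i"] ij assms(2) by (simp add: multiples_def p_def S.power_mem)
  have *: "y ^ (a + m * p) - y ^ a \<in> multiples c" if "a \<ge> i" for a m
  proof (induction m)
    case (Suc m)
    have e: "a + Suc m * p = i + p + (a - i + m * p)" "a + m * p = i + (a - i + m * p)"
      using that by auto
    have "y ^ (a + Suc m * p) - y ^ a =
        (y ^ (i + p) - y ^ i) * y ^ (a - i + m * p) + (y ^ (a + m * p) - y ^ a)"
      unfolding e power_add[of y "i + p"] power_add[of y i "a - i + m * p"] by (simp add: algebra_simps)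
    also have "\<dots> \<in> multiples c" using step Suc assms(2) by (intro multiples_add multiples_mult S.power_mem) auto
    finally show ?case .
  qed simp
  define n where "n = Suc i * p"
  have "n \<ge> i" using p by (cases p) (auto simp: n_def)
  then have "y ^ n * y ^ n - y ^ n \<in> multiples c"
    using *[of n "Suc i"] by (simp only: n_def power_add)
  moreover have "n > 0" using p by (simp add: n_def)
  ultimately show ?thesis using that by blast
qed

definition comaximal :: "'a \<Rightarrow> 'a \<Rightarrow> bool"
  where "comaximal x y \<longleftrightarrow> (\<exists>u\<in>S. \<exists>v\<in>S. x * u + y * v = 1)"

lemma comaximal_commute: "comaximal x y \<Longrightarrow> comaximal y x"
  unfolding comaximal_def by (metis add.commute)

lemma comaximal_mult:
  assumes "x \<in> S" "y \<in> S" "z \<in> S" "comaximal x z" "comaximal y z"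
  shows "comaximal (x * y) z"
proof -
  obtain u v u' v' where *: "u \<in> S" "v \<in> S" "u' \<in> S" "v' \<in> S" "x * u + z * v = 1" "y * u' + z * v' = 1"
    using assms by (auto simp: comaximal_def)
  have "(x * y) * (u * u') + z * (x * u * v' + v) =
      x * u * (y * u' + z * v') + z * v" by (simp add: algebra_simps)
  also have "\<dots> = 1" using * by simp
  finally show ?thesis
    unfolding comaximal_def using * assms(1-3)
    by (intro bexI[of _ "u * u'"] bexI[of _ "x * u * v' + v"] S.add_mem S.mult_mem)
qed

lemma comaximal_power: "x \<in> S \<Longrightarrow> z \<in> S \<Longrightarrow> comaximal x z \<Longrightarrow> comaximal (x ^ n) z"
proof (induction n)
  case 0
  show ?case unfolding comaximal_def by (intro bexI[of _ 1] bexI[of _ 0]) auto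
qed (auto intro!: comaximal_mult S.power_mem)

lemma comaximal_dvd: assumes "comaximal y z" "x \<noteq> 0" "y / x \<in> S" shows "comaximal x z"
proof -
  obtain u v where "u \<in> S" "v \<in> S" "y * u + z * v = 1" using assms(1) by (auto simp: comaximal_def)
  then show ?thesis
    unfolding comaximal_def using assms(2,3)
    by (intro bexI[of _ "y / x * u"] bexI[of _ v] S.mult_mem) auto
qed

lemma comaximal_dvd_mult:
  assumes "comaximal x z" "x \<noteq> 0" "w \<in> S" "z * w / x \<in> S" shows "w / x \<in> S"
proof -
  obtain u v where uv: "u \<in> S" "v \<in> S" "x * u + z * v = 1" using assms(1) by (auto simp: comaximal_def)
  have "w / x = w * (x * u + z * v) / x" using uv by simp
  also have "\<dots> = w * u + z * w / x * v" using assms(2) by (simp add: field_simps)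
  also have "\<dots> \<in> S" using assms uv by (intro S.mem)
  finally show ?thesis .
qed

text \<open>
  Let \<open>x\<^sub>1, x\<^sub>2, \<dots>\<close> be the entries of \<open>xs\<close>. Their partial products \<open>y j\<close> generate, together with \<open>z\<close>,
  a descending chain of ideals. The chain is strict: an equality \<open>y i = y j s + z t\<close> with \<open>i < j\<close>,
  multiplied by the remaining factors, shows that the next factor divides the cofactor \<open>w\<close> of \<open>z\<close>,
  hence is comaximal with \<open>z\<close>. As \<open>S / z S\<close> is finite, the length of such chains is bounded.
\<close>

lemma noncoprime_factors_bounded:
  assumes z: "z \<in> S" "z \<noteq> 0"
  obtains B :: nat where
    "\<And>xs w. \<lbrakk>set xs \<subseteq> S; w \<in> S; w \<noteq> 0; comaximal w z; prod_list xs = z * w; \<And>x. x \<in> set xs \<Longrightarrow> \<not> comaximal x z\<rbrakk>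
      \<Longrightarrow> length xs < B"
proof -
  obtain n :: nat where n: "n > 0" "of_nat n / z \<in> S" using divides_nat[OF z(1)] by metis
  obtain f :: "'a \<Rightarrow> nat \<Rightarrow> int" where f: "finite (f ` S)"
    "\<And>x y. \<lbrakk>x \<in> S; y \<in> S; f x = f y\<rbrakk> \<Longrightarrow> (x - y) / of_nat n \<in> S"
    using finite_residues[OF n(1)] by metis
  have "length xs < Suc (2 ^ card (f ` S))"
    if xs: "set xs \<subseteq> S" and w: "w \<in> S" "w \<noteq> 0" "comaximal w z" and prod: "prod_list xs = z * w"
      and ncomax: "\<And>x. x \<in> set xs \<Longrightarrow> \<not> comaximal x z" for xs w
  proof -
    define y where "y = (\<lambda>j. prod_list (take j xs))"
    have yS: "y j \<in> S" for j unfolding y_def using xs set_take_subset by (intro S.prod_list_mem) fast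
    \<comment> \<open>The ideals are distinguished through their residues modulo \<open>n\<close>, a multiple of \<open>z\<close>.\<close>
    define I where "I = (\<lambda>j. {y j * s + z * t | s t. s \<in> S \<and> t \<in> S})"
    have IS: "I j \<subseteq> S" for j using yS z by (auto simp: I_def intro!: S.mem)
    have neq: "f ` I i \<noteq> f ` I j" if ij: "i < j" "j \<le> length xs" for i j
    proof
      assume eq: "f ` I i = f ` I j"
      have "y i \<in> I i" unfolding I_def
        by (rule CollectI, rule exI[of _ 1], rule exI[of _ 0]) simp
      then obtain v where v: "v \<in> I j" "f (y i) = f v" using eq by blast
      then obtain s t where st: "v = y j * s + z * t" "s \<in> S" "t \<in> S" by (auto simp: I_def)
      have "(y i - v) / of_nat n \<in> S" using v yS IS f(2) by blast
      then have "(y i - v) / of_nat n * (of_nat n / z) \<in> S" using n(2) by (rule S.mult_mem)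
      then have t': "(y i - v) / z + t \<in> S" using n(1) st(3) by (simp add: S.add_mem)
      define t' where "t' = (y i - v) / z + t"
      have yi: "y i = y j * s + z * t'" using z(2) by (simp add: t'_def st(1) field_simps)
      define x where "x = xs ! i"
      have x: "x \<in> set xs" using ij by (simp add: x_def)
      define p where "p = prod_list (take (j - Suc i) (drop (Suc i) xs))"
      define r where "r = prod_list (drop (Suc i) xs)"
      have pS: "p \<in> S" "r \<in> S" unfolding p_def r_def using xs
        by (auto intro!: S.prod_list_mem dest!: in_set_takeD in_set_dropD)
      have "take j xs = take i xs @ [x] @ take (j - Suc i) (drop (Suc i) xs)"
      proof -
        have "take j xs = take (Suc i) xs @ take (j - Suc i) (drop (Suc i) xs)"
          using ij(1) by (simp flip: take_add)
        then show ?thesis using ij by (simp add: take_Suc_conv_app_nth x_def)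
      qed
      then have yj: "y j = y i * (x * p)" by (simp add: y_def p_def)
      have "xs = take i xs @ x # drop (Suc i) xs"
        using ij by (simp add: x_def id_take_nth_drop)
      then have "prod_list xs = y i * (x * r)"
        by (metis prod_list.append prod_list.Cons y_def r_def)
      then have zw: "z * w = y i * (x * r)" using prod by simp
      also have "\<dots> = y j * s * (x * r) + z * t' * (x * r)" by (subst yi) (simp add: algebra_simps)
      also have "y j * s * (x * r) = x * p * s * (y i * (x * r))" unfolding yj by (simp add: mult_ac)
      also have "y i * (x * r) = z * w" by (rule zw[symmetric])
      finally have "z * w = z * (x * (p * s * w + t' * r))" by (simp add: algebra_simps)
      then have w_eq: "w = x * (p * s * w + t' * r)" using z(2) by simp
      then have "x \<noteq> 0" using w(2) by auto
      then have "w / x = p * s * w + t' * r" by (subst w_eq) simp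
      also have "\<dots> \<in> S" using pS st w(1) t' by (auto simp: t'_def intro!: S.add_mem S.mult_mem)
      finally have "comaximal x z" using comaximal_dvd w(3) \<open>x \<noteq> 0\<close> by blast
      then show False using ncomax x by blast
    qed
    then have "inj_on (\<lambda>j. f ` I j) {0..length xs}"
      by (intro inj_onI) (metis atLeastAtMost_iff nat_neq_iff)
    moreover have "(\<lambda>j. f ` I j) ` {0..length xs} \<subseteq> Pow (f ` S)" using IS by blast
    ultimately have "card {0..length xs} \<le> card (Pow (f ` S))"
      using f(1) by (intro card_inj_on_le[of "\<lambda>j. f ` I j"]) auto
    then show ?thesis using f(1) by (simp add: card_Pow)
  qed
  then show ?thesis using that by blast
qed

text \<open>
  The element \<open>t\<close> generates a power of the part of \<open>c S\<close> at the primes where the idempotent \<open>k\<close> is \<open>1\<close>: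
  it is nilpotent there (\<open>k t \<in> c S\<close>) and divides powers of \<open>1 - k\<close> and of \<open>c\<close>, so it is a unit at all
  other primes. It is obtained as the quotient \<open>q\<close> of two equivalent ideals \<open>U i\<close> and \<open>U j\<close>, where
  \<open>U i\<close> consists of the elements divisible by \<open>c\<^sup>i\<close> at the primes where \<open>k\<close> is \<open>1\<close>.
\<close>

lemma element_supported_on_idempotent:
  assumes c: "c > 0" and cR: "\<And>x. x \<in> S \<Longrightarrow> of_nat c * x \<in> R"
    and k: "k \<in> S" "k * k - k \<in> multiples c"
  obtains t n where "t \<in> S" "t \<noteq> 0" "t * t - t \<in> multiples c" "k * t \<in> multiples c"
    "(1 - k) ^ n / t \<in> S" "of_nat c ^ n / t \<in> S"
proof -
  define U where "U = (\<lambda>i::nat. {u \<in> S. \<exists>m. k ^ m * u / of_nat c ^ i \<in> S})"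
  have c_mem: "of_nat c ^ i \<in> U i" for i
    unfolding U_def using c by (auto intro: exI[of _ 0] S.power_mem[OF S.of_nat_mem])
  have "S_ideal (U i)" for i
    unfolding S_ideal_def
  proof (intro conjI ballI)
    show "\<exists>u\<in>U i. u \<noteq> 0" using c by (intro bexI[OF _ c_mem]) auto
  next
    fix u v assume u: "u \<in> U i" and v: "v \<in> U i"
    then obtain m n where mn: "k ^ m * u / of_nat c ^ i \<in> S" "k ^ n * v / of_nat c ^ i \<in> S"
      by (auto simp: U_def)
    have "k ^ (m + n) * (u - v) / of_nat c ^ i =
        k ^ n * (k ^ m * u / of_nat c ^ i) - k ^ m * (k ^ n * v / of_nat c ^ i)"
      by (simp add: power_add diff_divide_distrib algebra_simps)
    also have "\<dots> \<in> S" using mn k(1) by (intro S.diff_mem S.mult_mem[OF S.power_mem])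
    finally show "u - v \<in> U i" using u v by (auto simp: U_def intro: S.diff_mem)
  next
    fix s u assume s: "s \<in> S" and u: "u \<in> U i"
    then obtain m where m: "k ^ m * u / of_nat c ^ i \<in> S" by (auto simp: U_def)
    then have "k ^ m * (s * u) / of_nat c ^ i \<in> S" using S.mult_mem[OF s m] by (simp add: mult_ac)
    then show "s * u \<in> U i" using s u by (auto simp: U_def intro: S.mult_mem)
  qed (auto simp: U_def)
  then obtain i j q where q: "i < j" "q \<in> K" "q \<noteq> 0" "U j = (\<lambda>u. q * u) ` U i"
    by (metis ideal_classes_finite)
  have "U j \<subseteq> U i"
  proof
    fix u assume "u \<in> U j"
    then obtain m where m: "k ^ m * u / of_nat c ^ j \<in> S" "u \<in> S" by (auto simp: U_def)
    have "k ^ m * u / of_nat c ^ i = of_nat c ^ (j - i) * (k ^ m * u / of_nat c ^ j)"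
      using q(1) c by (simp add: power_diff)
    also have "\<dots> \<in> S" using m by (intro S.mult_mem[OF S.power_mem[OF S.of_nat_mem]])
    finally show "u \<in> U i" using m by (auto simp: U_def)
  qed
  then have "of_nat c ^ i * q ^ n \<in> U i" for n
  proof (induction n)
    case (Suc n)
    then have "q * (of_nat c ^ i * q ^ n) \<in> U j" using q(4) by blast
    then show ?case using Suc.prems by (auto simp: mult_ac)
  qed (use c_mem in simp)
  \<comment> \<open>\<open>U i\<close> is stable under \<open>q\<close>, so \<open>c\<close> to the power \<open>i\<close> is a common denominator of all powers of \<open>q\<close>.\<close>
  then have qS: "q \<in> S"
    using c cR by (intro S_completely_closed[of "of_nat c ^ i" c]) (auto simp: U_def K.power_mem)
  have kq: "k * q \<in> multiples c"
  proof -
    have "q * of_nat c ^ i \<in> U j" unfolding q(4) using c_mem by blast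
    then obtain m where m: "k ^ m * (q * of_nat c ^ i) / of_nat c ^ j \<in> S" by (auto simp: U_def)
    have "k ^ Suc m * q / of_nat c = k * of_nat c ^ (j - Suc i) * (k ^ m * (q * of_nat c ^ i) / of_nat c ^ j)"
      using q(1) c by (simp add: power_diff field_simps)
    also have "\<dots> \<in> S" using m k(1) by (intro S.mult_mem[OF S.mult_mem[OF _ S.power_mem[OF S.of_nat_mem]]])
    finally have "k ^ Suc m * q \<in> multiples c" by (simp add: multiples_def)
    moreover have "k ^ Suc m - k \<in> multiples c" using k by (intro multiples_power_diff) auto
    then have "(k ^ Suc m - k) * q \<in> multiples c" using qS by (rule multiples_mult)
    ultimately have "k ^ Suc m * q - (k ^ Suc m - k) * q \<in> multiples c" by (rule multiples_diff)
    then show ?thesis by (simp add: algebra_simps)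
  qed
  have div: "u / q \<in> S" if "u \<in> U j" for u
    using that q(3) unfolding q(4) by (auto simp: U_def)
  have "(1 - k) ^ j \<in> U j"
  proof -
    have "k ^ j * (1 - k) ^ j / of_nat c ^ j = (- ((k * k - k) / of_nat c)) ^ j"
      by (simp add: power_mult_distrib[symmetric] power_divide[symmetric] algebra_simps
          minus_divide_left)
    also have "\<dots> \<in> S" using k(2) by (intro S.mem) (simp add: multiples_def)
    finally show ?thesis unfolding U_def using k(1) by (auto intro!: S.power_mem S.diff_mem)
  qed
  then have div1: "(1 - k) ^ j / q \<in> S" by (rule div)
  have div2: "of_nat c ^ j / q \<in> S" using c_mem by (rule div)
  obtain n where n: "n > 0" "q ^ n * q ^ n - q ^ n \<in> multiples c"
    using idempotent_power[OF c qS] by metis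
  show ?thesis
  proof (rule that[of "q ^ n" "j * n"])
    have "k * q ^ n = k * q * q ^ (n - 1)" using n(1) by (cases n) auto
    also have "\<dots> \<in> multiples c" using qS by (intro multiples_mult[OF kq] S.power_mem)
    finally show "k * q ^ n \<in> multiples c" .
    have "(1 - k) ^ (j * n) / q ^ n = ((1 - k) ^ j / q) ^ n"
      by (simp add: power_mult power_divide)
    then show "(1 - k) ^ (j * n) / q ^ n \<in> S" using S.power_mem[OF div1] by simp
    have "of_nat c ^ (j * n) / q ^ n = (of_nat c ^ j / q) ^ n"
      by (simp add: power_mult power_divide)
    then show "of_nat c ^ (j * n) / q ^ n \<in> S" using S.power_mem[OF div2] by simp
  qed (use n qS q(3) in \<open>auto intro: S.power_mem\<close>)
qed

text \<open>
  The elements of \<open>R\<close> that are idempotent modulo \<open>c S\<close> and are supported where \<open>z \<equiv> 1\<close>. For \<open>z\<close>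
  idempotent, this is the order relation of the Boolean algebra of idempotents of \<open>S / c S\<close>.
\<close>

definition dominated :: "nat \<Rightarrow> 'a \<Rightarrow> 'a set"
  where "dominated c z = {e \<in> R. e * e - e \<in> multiples c \<and> e * z - e \<in> multiples c}"

text \<open>
  Dominated idempotents are closed under the join \<open>g + f - g f\<close>, so the join of representatives of
  the finitely many residue classes dominates all of them.
\<close>

lemma greatest_dominated_idempotent:
  assumes c: "c > 0" and z: "z \<in> S"
  obtains \<epsilon> where "\<epsilon> \<in> dominated c z" "\<And>e. e \<in> dominated c z \<Longrightarrow> e * \<epsilon> - e \<in> multiples c"
proof -
  have ES: "e \<in> S" if "e \<in> dominated c z" for e using that R_subset_S by (auto simp: dominated_def)
  have fin: "\<exists>g\<in>dominated c z. \<forall>e\<in>F. e * g - e \<in> multiples c" if "finite F" "F \<subseteq> dominated c z" for F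
    using that
  proof (induction F)
    case empty
    have "0 \<in> dominated c z" by (simp add: dominated_def)
    then show ?case by auto
  next
    case (insert f F)
    then obtain g where g: "g \<in> dominated c z" "\<forall>e\<in>F. e * g - e \<in> multiples c" by auto
    have f: "f \<in> dominated c z" using insert by auto
    define h where "h = g + f - g * f"
    have hR: "h \<in> R" unfolding h_def using f g by (auto simp: dominated_def intro!: mem)
    have 1: "g * g - g \<in> multiples c" "g * z - g \<in> multiples c" "f * f - f \<in> multiples c" "f * z - f \<in> multiples c"
      using f g by (auto simp: dominated_def)
    have "h * h - h = (g * g - g) * (1 - f) + (f * f - f) * ((1 - g) + (g * g - g))"
      by (simp add: h_def algebra_simps)
    also have "\<dots> \<in> multiples c" using 1 ES[OF f] ES[OF g(1)] by (intro multiples_add multiples_mult S.mem) auto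
    finally have h1: "h * h - h \<in> multiples c" .
    have "h * z - h = (g * z - g) + (f * z - f) * (1 - g)"
      by (simp add: h_def algebra_simps)
    also have "\<dots> \<in> multiples c" using 1 ES[OF f] ES[OF g(1)] by (intro multiples_add multiples_mult S.mem) auto
    finally have "h \<in> dominated c z" using h1 hR by (simp add: dominated_def)
    moreover have "e * h - e \<in> multiples c" if "e \<in> F" for e
    proof -
      have "e * h - e = (e * g - e) * (1 - f)" by (simp add: h_def algebra_simps)
      also have "\<dots> \<in> multiples c" using g(2) that ES[OF f] by (intro multiples_mult S.mem) auto
      finally show ?thesis .
    qed
    moreover have "f * h - f \<in> multiples c"
    proof -
      have "f * h - f = (f * f - f) * (1 - g)" by (simp add: h_def algebra_simps)
      also have "\<dots> \<in> multiples c" using 1 ES[OF g(1)] by (intro multiples_mult S.mem) auto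
      finally show ?thesis .
    qed
    ultimately show ?case by blast
  qed
  obtain f :: "'a \<Rightarrow> nat \<Rightarrow> int" where f: "finite (f ` S)"
    "\<And>x y. \<lbrakk>x \<in> S; y \<in> S; f x = f y\<rbrakk> \<Longrightarrow> (x - y) / of_nat c \<in> S"
    using finite_residues[OF c] by metis
  have "finite (f ` dominated c z)"
    by (rule finite_subset[OF _ f(1)]) (use ES in blast)
  then obtain F where F: "F \<subseteq> dominated c z" "finite F" "f ` dominated c z = f ` F"
    using finite_subset_image[of "f ` dominated c z" f "dominated c z"] by blast
  obtain g where g: "g \<in> dominated c z" "\<forall>e\<in>F. e * g - e \<in> multiples c" using fin F by blast
  have "e * g - e \<in> multiples c" if e: "e \<in> dominated c z" for e
  proof -
    obtain e' where e': "e' \<in> F" "f e = f e'" using F(3) e by blast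
    have "e - e' \<in> multiples c" using f(2)[of e e'] e e' F(1) ES by (auto simp: multiples_def)
    then have "(e - e') * (g - 1) + (e' * g - e') \<in> multiples c"
      using g e' ES by (intro multiples_add multiples_mult S.mem) auto
    then show ?thesis by (simp add: algebra_simps)
  qed
  then show ?thesis using that g(1) by blast
qed

end

section \<open>Elements of boundary zero\<close>

text \<open>
  The properties of the boundary map of a half-factorial order on which the argument rests. The
  condition \<open>inverse y \<notin> R\<close> says that \<open>y\<close> is a nonzero nonunit of \<open>R\<close>: the inverse of \<open>0\<close> is \<open>0\<close>.
\<close>

locale boundary_order = integer_order +
  fixes bd :: "'a \<Rightarrow> int"
  assumes bd_mult: "x \<in> K \<Longrightarrow> y \<in> K \<Longrightarrow> x \<noteq> 0 \<Longrightarrow> y \<noteq> 0 \<Longrightarrow> bd (x * y) = bd x + bd y"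
    and bd_nonneg: "x \<in> R \<Longrightarrow> x \<noteq> 0 \<Longrightarrow> bd x \<ge> 0"
    and bd_unit: "x \<in> R \<Longrightarrow> x \<noteq> 0 \<Longrightarrow> bd x = 0 \<Longrightarrow> inverse x \<in> R"
    and bd_factors: "x \<in> R \<Longrightarrow> x \<noteq> 0 \<Longrightarrow> bd x > 0 \<Longrightarrow>
      \<exists>xs. set xs \<subseteq> R \<and> prod_list xs = x \<and> int (length xs) = bd x \<and> (\<forall>y\<in>set xs. inverse y \<notin> R)"
begin

lemma bd_one [simp]: "bd 1 = 0"
  using bd_mult[of 1 1] by simp

lemma bd_power: "x \<in> K \<Longrightarrow> x \<noteq> 0 \<Longrightarrow> bd (x ^ n) = int n * bd x"
  by (induction n) (auto simp: bd_mult K.power_mem algebra_simps)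

text \<open>A negative boundary of \<open>x\<close> would make the boundary of \<open>m x\<^sup>n \<in> R\<close> negative for large \<open>n\<close>.\<close>

lemma bd_nonneg_S: assumes "x \<in> S" "x \<noteq> 0" shows "bd x \<ge> 0"
proof (rule ccontr)
  assume neg: "\<not> bd x \<ge> 0"
  obtain m where m: "m > 0" "\<And>n. of_nat m * x ^ n \<in> R" using assms by (metis SE)
  define n where "n = nat (bd (of_nat m)) + 1"
  have "bd (of_nat m) \<ge> 0" using m(1) by (intro bd_nonneg) auto
  have "0 \<le> bd (of_nat m * x ^ n)" using m assms by (intro bd_nonneg) auto
  also have "\<dots> = bd (of_nat m) + int n * bd x"
    using m(1) assms by (simp add: bd_mult bd_power K.power_mem S_subset_K)
  also have "\<dots> \<le> bd (of_nat m) + int n * (- 1)" using neg by (intro add_left_mono mult_left_mono) auto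
  finally show False using \<open>bd (of_nat m) \<ge> 0\<close> by (simp add: n_def)
qed

lemma unit_R_of_unit_S: assumes "x \<in> R" "x \<noteq> 0" "inverse x \<in> S" shows "inverse x \<in> R"
proof -
  have "bd x + bd (inverse x) = 0"
    using bd_mult[of x "inverse x"] assms by (simp add: R_subset_K S_subset_K)
  moreover have "bd x \<ge> 0" "bd (inverse x) \<ge> 0"
    using assms by (simp_all add: bd_nonneg bd_nonneg_S)
  ultimately show ?thesis using assms by (intro bd_unit) auto
qed

text \<open>
  Modulo \<open>c S\<close> the number \<open>1\<close> is the sum of the orthogonal idempotents \<open>\<epsilon>\<close>, \<open>k = (1 - \<epsilon>) z\<close> and \<open>1 - z\<close>.
  They correspond to a partition of the primes dividing \<open>c\<close>: those lying above primes of \<open>R\<close> with no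
  prime above that contains \<open>z\<close>; the primes not containing \<open>z\<close> that share their prime of \<open>R\<close> with one
  that does; and the primes containing \<open>z\<close>. The element \<open>t\<close> is supported on \<open>k\<close>, so that \<open>z t\<^sup>n \<equiv> \<epsilon>\<close> lies in \<open>R\<close>, although \<open>z\<close> itself need not.
\<close>

lemma idempotent_bd_zero_unit:
  assumes c: "c > 0" and cR: "\<And>x. x \<in> S \<Longrightarrow> of_nat c * x \<in> R"
    and z: "z \<in> S" "z \<noteq> 0" "bd z = 0" "z * z - z \<in> multiples c"
  shows "inverse z \<in> S"
proof (rule ccontr)
  assume nonunit: "inverse z \<notin> S"
  have multiples_R: "x \<in> R" if "x \<in> multiples c" for x using cR[of "x / of_nat c"] c that by (simp add: multiples_def)
  obtain \<epsilon> where \<epsilon>: "\<epsilon> \<in> dominated c z" "\<And>e. e \<in> dominated c z \<Longrightarrow> e * \<epsilon> - e \<in> multiples c"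
    using greatest_dominated_idempotent[OF c z(1)] by metis
  have \<epsilon>R: "\<epsilon> \<in> R" and \<epsilon>1: "\<epsilon> * \<epsilon> - \<epsilon> \<in> multiples c" and \<epsilon>2: "\<epsilon> * z - \<epsilon> \<in> multiples c"
    using \<epsilon>(1) by (auto simp: dominated_def)
  have \<epsilon>S: "\<epsilon> \<in> S" using \<epsilon>R by (rule R_subset_S)
  define k where "k = (1 - \<epsilon>) * z"
  have kS: "k \<in> S" unfolding k_def using \<epsilon>S z(1) by (intro S.mem) auto
  have "k * k - k = (\<epsilon> * \<epsilon> - \<epsilon>) * (z * z) + (z * z - z) * (1 - \<epsilon>)"
    by (simp add: k_def algebra_simps)
  also have "\<dots> \<in> multiples c" using \<epsilon>1 z \<epsilon>S by (intro multiples_add multiples_mult S.mem) auto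
  finally have kk: "k * k - k \<in> multiples c" .
  obtain t N where t: "t \<in> S" "t \<noteq> 0" "t * t - t \<in> multiples c" "k * t \<in> multiples c"
    "(1 - k) ^ N / t \<in> S" "of_nat c ^ N / t \<in> S"
    using element_supported_on_idempotent[OF c cR kS kk] by metis
  have \<epsilon>k: "\<epsilon> * (1 - k) ^ n - \<epsilon> \<in> multiples c" for n
  proof (induction n)
    case (Suc n)
    have "\<epsilon> * (1 - k) ^ Suc n - \<epsilon> = (\<epsilon> * (1 - k) ^ n - \<epsilon>) * (1 - k) + (\<epsilon> * \<epsilon> - \<epsilon>) * z"
      by (simp add: k_def algebra_simps)
    also have "\<dots> \<in> multiples c" using Suc \<epsilon>1 kS z(1) by (intro multiples_add multiples_mult S.mem) auto
    finally show ?case .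
  qed simp
  define s where "s = (1 - k) ^ N / t"
  have s: "s \<in> S" "(1 - k) ^ N = t * s" using t by (auto simp: s_def)
  have \<epsilon>ts: "\<epsilon> * (t * s) - \<epsilon> \<in> multiples c" using \<epsilon>k[of N] s by simp
  have "\<epsilon> * t - \<epsilon> = (\<epsilon> * (t * s) - \<epsilon>) * (1 - t) + (t * t - t) * (\<epsilon> * s)"
    by (simp add: algebra_simps)
  also have "\<dots> \<in> multiples c" using \<epsilon>ts t s \<epsilon>S by (intro multiples_add multiples_mult S.mem) auto
  finally have \<epsilon>t: "\<epsilon> * t - \<epsilon> \<in> multiples c" .
  have "z * t - \<epsilon> = (\<epsilon> * z - \<epsilon>) * t + (\<epsilon> * t - \<epsilon>) + k * t"
    by (simp add: k_def algebra_simps)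
  also have "\<dots> \<in> multiples c" using \<epsilon>2 \<epsilon>t t(1,4) by (intro multiples_add multiples_mult[OF \<epsilon>2])
  finally have zt: "z * t - \<epsilon> \<in> multiples c" .
  have tpow: "t ^ n - t \<in> multiples c" if "n > 0" for n using multiples_power_diff t that by blast
  have ztR: "z * t ^ n \<in> R" if "n > 0" for n
  proof -
    have "z * t ^ n = \<epsilon> + ((t ^ n - t) * z + (z * t - \<epsilon>))" by (simp add: algebra_simps)
    also have "\<dots> \<in> R" using tpow[OF that] zt z(1) by (intro add_mem \<epsilon>R multiples_R multiples_add multiples_mult)
    finally show ?thesis .
  qed
  have "comaximal (1 - k) z" unfolding comaximal_def k_def using \<epsilon>S
    by (intro bexI[of _ 1] bexI[of _ "1 - \<epsilon>"] S.mem) (auto simp: algebra_simps)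
  then have "comaximal ((1 - k) ^ N) z" using kS z(1) by (intro comaximal_power S.mem) auto
  then have comaximal_t: "comaximal t z" by (rule comaximal_dvd[OF _ t(2,5)])
  \<comment> \<open>If a factor \<open>x\<close> of \<open>z t\<^sup>n\<close> in \<open>R\<close> is comaximal with \<open>z\<close>, then the complement \<open>e\<close> of an idempotent
    power of \<open>x\<close> is dominated by \<open>z\<close>, hence by \<open>\<epsilon>\<close>. But \<open>x\<close> divides \<open>t\<^sup>n\<close>, a unit where \<open>\<epsilon>\<close> is \<open>1\<close>; so
    \<open>e\<close> vanishes and \<open>x\<close> is comaximal with \<open>c\<close>, while it divides a power of \<open>c\<close>.\<close>
  have noncomaximal: "inverse x \<in> R"
    if x: "x \<in> R" "x \<noteq> 0" "z * t ^ n / x \<in> S" "comaximal x z" and n: "n > 0" for x n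
  proof -
    have xS: "x \<in> S" using x by (intro R_subset_S)
    define y where "y = t ^ n / x"
    have y: "y \<in> S" "t ^ n = x * y"
      using comaximal_dvd_mult[OF x(4,2) S.power_mem[OF t(1)] x(3)] x(2) by (auto simp: y_def)
    obtain m where m: "m > 0" "x ^ m * x ^ m - x ^ m \<in> multiples c"
      using idempotent_power[OF c xS] by metis
    define \<eta> where "\<eta> = x ^ m"
    have \<eta>: "\<eta> \<in> R" "\<eta> \<in> S" "\<eta> * \<eta> - \<eta> \<in> multiples c"
      using m x(1) xS by (auto simp: \<eta>_def intro: power_mem S.power_mem)
    have "comaximal \<eta> z" unfolding \<eta>_def using xS z(1) x(4) by (rule comaximal_power)
    then obtain u v where uv: "u \<in> S" "v \<in> S" "\<eta> * u + z * v = 1" by (auto simp: comaximal_def)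
    define e where "e = 1 - \<eta>"
    have eR: "e \<in> R" and eS: "e \<in> S" unfolding e_def using \<eta> by (auto intro: diff_mem S.diff_mem)
    have "e * e - e = \<eta> * \<eta> - \<eta>" by (simp add: e_def algebra_simps)
    then have ee: "e * e - e \<in> multiples c" using \<eta>(3) by simp
    have "e * \<eta> = - (\<eta> * \<eta> - \<eta>)" by (simp add: e_def algebra_simps)
    then have e\<eta>: "e * \<eta> \<in> multiples c" using multiples_uminus[OF \<eta>(3)] by (simp only:)
    have "e * z - e = e * (z - 1) * (\<eta> * u + z * v)" using uv by (simp add: algebra_simps)
    also have "\<dots> = (e * \<eta>) * (u * (z - 1)) + (z * z - z) * (e * v)" by (simp add: algebra_simps)
    also have "\<dots> \<in> multiples c" using z eS uv by (intro multiples_add multiples_mult[OF e\<eta>] multiples_mult[OF z(4)] S.mem) auto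
    finally have "e \<in> dominated c z" using eR ee by (simp add: dominated_def)
    then have e\<epsilon>: "e * \<epsilon> - e \<in> multiples c" by (rule \<epsilon>(2))
    have tnm: "t ^ (n * m) = \<eta> * y ^ m" by (simp add: power_mult y(2) \<eta>_def power_mult_distrib)
    have "e = - (e * \<epsilon> - e) - (\<epsilon> * t - \<epsilon>) * e - (t ^ (n * m) - t) * (e * \<epsilon>) + (e * \<eta>) * (\<epsilon> * y ^ m)"
      unfolding tnm by (simp add: algebra_simps)
    also have "\<dots> \<in> multiples c"
      using n m(1) eS \<epsilon>S y(1)
      by (intro multiples_add[OF multiples_diff[OF multiples_diff[OF multiples_uminus[OF e\<epsilon>] multiples_mult[OF \<epsilon>t]] multiples_mult[OF tpow]]
            multiples_mult[OF e\<eta>]] S.mult_mem S.power_mem) auto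
    finally have eZ: "e / of_nat c \<in> S" by (simp add: multiples_def)
    have "x * x ^ (m - 1) = \<eta>" using m(1) by (cases m) (auto simp: \<eta>_def)
    then have "x * x ^ (m - 1) + of_nat c * (e / of_nat c) = 1" using c by (simp add: e_def)
    then have comaximal_c: "comaximal x (of_nat c)"
      unfolding comaximal_def using S.power_mem[OF xS] eZ by blast
    have "comaximal x (of_nat c ^ (N * n))"
      by (rule comaximal_commute[OF comaximal_power[OF S.of_nat_mem xS comaximal_commute[OF comaximal_c]]])
    moreover have "of_nat c ^ (N * n) * 1 / x = (of_nat c ^ N / t) ^ n * y"
      using t(2) x(2) by (simp add: y_def power_mult power_divide)
    then have "of_nat c ^ (N * n) * 1 / x \<in> S" using t(6) y(1) by (simp only:) (intro S.mem)
    ultimately have "1 / x \<in> S" using comaximal_dvd_mult[OF _ x(2) S.one_mem] by blast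
    then show ?thesis using x by (intro unit_R_of_unit_S) (auto simp: divide_inverse)
  qed
  have "bd t \<noteq> 0"
  proof
    assume "bd t = 0"
    then have "bd (z * t) = 0" using z t by (simp add: bd_mult S_subset_K)
    then have "inverse (z * t) \<in> R" using ztR[of 1] z t by (intro bd_unit) auto
    then have "t * inverse (z * t) \<in> S" by (rule S.mult_mem[OF t(1) R_subset_S])
    moreover have "t * inverse (z * t) = inverse z" using t(2) by simp
    ultimately show False using nonunit by (simp only:)
  qed
  then have bdt: "bd t \<ge> 1" using bd_nonneg_S[OF t(1,2)] by linarith
  obtain B where B: "\<And>xs w. \<lbrakk>set xs \<subseteq> S; w \<in> S; w \<noteq> 0; comaximal w z; prod_list xs = z * w;
      \<And>x. x \<in> set xs \<Longrightarrow> \<not> comaximal x z\<rbrakk> \<Longrightarrow> length xs < B"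
    using noncoprime_factors_bounded[OF z(1,2)] by blast
  define n where "n = Suc B"
  have bdn: "bd (z * t ^ n) = int n * bd t"
    using z t by (simp add: bd_mult bd_power S_subset_K K.power_mem)
  also have "\<dots> \<ge> int n * 1" using bdt by (intro mult_left_mono) auto
  finally have ge: "bd (z * t ^ n) \<ge> int n" by simp
  then obtain xs where xs: "set xs \<subseteq> R" "prod_list xs = z * t ^ n"
    "int (length xs) = bd (z * t ^ n)" "\<forall>y\<in>set xs. inverse y \<notin> R"
    using bd_factors[OF ztR[of n]] z t by (auto simp: n_def)
  have "length xs < B"
  proof (rule B)
    show "comaximal (t ^ n) z" using comaximal_t t z by (intro comaximal_power)
    fix x assume x: "x \<in> set xs"
    then obtain as bs where split: "xs = as @ x # bs" by (auto simp: in_set_conv_decomp)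
    have "z * t ^ n = x * (prod_list as * prod_list bs)"
      using xs(2) by (simp add: split mult_ac)
    moreover from this have x0: "x \<noteq> 0" using z t by auto
    ultimately have "z * t ^ n / x = prod_list as * prod_list bs" by simp
    also have "\<dots> \<in> S" using xs(1) by (intro S.mult_mem S.prod_list_mem) (auto simp: split intro: R_subset_S)
    finally show "\<not> comaximal x z" using noncomaximal[of x n] x xs(1,4) x0 by (auto simp: n_def)
  qed (use xs t R_subset_S in \<open>auto intro: S.power_mem\<close>)
  then show False using xs(3) ge by (simp add: n_def)
qed

text \<open>
  An idempotent power of \<open>z\<close> modulo \<open>c S\<close> is a unit of \<open>S\<close>, hence congruent to \<open>1\<close>.
\<close>

theorem bd_zero_power_unit:
  assumes z: "z \<in> S" "z \<noteq> 0" "bd z = 0"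
  obtains n where "n > 0" "z ^ n \<in> R" "inverse (z ^ n) \<in> R"
proof -
  obtain c :: nat where c: "c > 0" "\<And>x. x \<in> S \<Longrightarrow> of_nat c * x \<in> R"
    by (metis conductor)
  obtain n where n: "n > 0" "z ^ n * z ^ n - z ^ n \<in> multiples c"
    using idempotent_power[OF c(1) z(1)] by metis
  have bd: "bd (z ^ n) = 0" using z by (simp add: bd_power S_subset_K)
  have "inverse (z ^ n) \<in> S"
    using c n z bd by (intro idempotent_bd_zero_unit[of c]) (auto intro: S.power_mem)
  then have "(z ^ n * z ^ n - z ^ n) * inverse (z ^ n) \<in> multiples c" using n(2) by (intro multiples_mult)
  also have "(z ^ n * z ^ n - z ^ n) * inverse (z ^ n) = z ^ n - 1"
    using z(2) by (simp add: field_simps)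
  finally have "z ^ n - 1 \<in> R" using c(2)[of "(z ^ n - 1) / of_nat c"] c(1) by (simp add: multiples_def)
  then have "z ^ n \<in> R" using add_mem[OF _ one_mem] by fastforce
  then show ?thesis using that[OF n(1)] bd_unit[OF _ _ bd] z(2) by simp
qed

end

section \<open>The boundary map of a half-factorial domain\<close>

lemma ambient_simps [simp]:
  "carrier (ring_on R) = R" "carrier ambient = UNIV" "\<zero>\<^bsub>ambient\<^esub> = (0 :: 'a :: field_char_0)" "\<one>\<^bsub>ambient\<^esub> = (1 :: 'a)"
  "x \<otimes>\<^bsub>ambient\<^esub> y = x * (y :: 'a)" "x \<oplus>\<^bsub>ambient\<^esub> y = x + y"
  by (simp_all add: ring_of_type_algebra_def)

lemma field_subring_if_subring:
  fixes R :: "'a :: field_char_0 set"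
  assumes "subring R ambient"
  shows "field_subring R"
proof
  interpret A: ring "ambient :: 'a ring" by (rule ring_from_type_algebra)
  note sub = subringE[OF assms, simplified]
  have neg: "\<ominus>\<^bsub>ambient\<^esub> y = - y" for y :: 'a
    using A.r_neg[of y] by (simp add: eq_neg_iff_add_eq_0 add.commute)
  show "1 \<in> R" by (rule sub)
  fix x y assume "x \<in> R" "y \<in> R"
  then show "x * y \<in> R" by (rule sub)
  show "x - y \<in> R" using sub(7)[OF \<open>x \<in> R\<close> sub(5)[OF \<open>y \<in> R\<close>]] by (simp add: neg)
qed

lemma Units_ring_on:
  fixes A :: "'a :: field_char_0 set"
  shows "z \<in> Units (ring_on A) \<longleftrightarrow> z \<in> A \<and> z \<noteq> 0 \<and> inverse z \<in> A"
proof
  assume "z \<in> Units (ring_on A)"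
  then obtain y where y: "z \<in> A" "y \<in> A" "y * z = 1" by (auto simp: Units_def)
  then have "z \<noteq> 0" "y = inverse z" by (auto intro: inverse_unique[symmetric] simp: mult.commute)
  then show "z \<in> A \<and> z \<noteq> 0 \<and> inverse z \<in> A" using y by simp
qed (auto simp: Units_def intro!: bexI[of _ "inverse z"])

lemma finite_dimension_span:
  fixes E :: "'a :: field_char_0 set"
  assumes "ring.finite_dimension ambient \<rat> E"
  shows "\<exists>F. finite F \<and> E \<subseteq> Q.span F"
proof -
  interpret A: ring "ambient :: 'a ring" by (rule ring_from_type_algebra)
  obtain n where "A.dimension n \<rat> E" using assms by (auto simp: A.finite_dimension_def)
  then show ?thesis
  proof (induction n "\<rat> :: 'a set" E rule: A.dimension.induct)
    case (Suc_dim v E n)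
    then obtain F where F: "finite F" "E \<subseteq> Q.span F" by auto
    have "u \<in> Q.span (insert v F)" if u: "u \<in> A.line_extension \<rat> v E" for u
    proof -
      obtain r e where "r \<in> \<rat>" "u = r * v + e" "e \<in> E"
        using u A.line_extension_mem_iff[of u \<rat> v E] by auto
      then obtain q where "u = of_rat q * v + e" "e \<in> E" by (auto elim: Rats_cases)
      moreover have "e \<in> Q.span (insert v F)" if "e \<in> E" for e
        using F(2) that Q.span_mono[of F "insert v F"] by blast
      ultimately show ?thesis
        by (auto intro!: Q.span_add Q.span_scale[OF Q.span_base])
    qed
    then show ?case using F(1) by (intro exI[of _ "insert v F"]) auto
  qed (auto intro: exI[of _ "{}"])
qed

context
  fixes R :: "'a :: field_char_0 set"
  assumes hfd: "half_factorial_domain (ring_on R)"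
begin

interpretation half_factorial_domain "ring_on R"
  by (rule hfd)

lemma one_mem_hfd: "1 \<in> R"
  using one_closed by simp

lemma boundary_eqI:
  assumes "boundary_value R x k" "x \<in> quotient_field R" "x \<noteq> 0"
  shows "boundary R x = k"
  unfolding boundary_def using boundary_value_ex1[OF hfd assms(2,3)] assms(1) by (rule the1_equality)

lemma boundary_value_boundary:
  assumes "x \<in> quotient_field R" "x \<noteq> 0"
  shows "boundary_value R x (boundary R x)"
  unfolding boundary_def using boundary_value_ex1[OF hfd assms] by (rule theI')

lemma boundary_mult:
  assumes "x \<in> quotient_field R" "y \<in> quotient_field R" "x * y \<in> quotient_field R" "x \<noteq> 0" "y \<noteq> 0"
  shows "boundary R (x * y) = boundary R x + boundary R y"
proof (rule boundary_eqI)
  obtain a b fs gs where 1: "a \<in> R - {0}" "b \<in> R - {0}" "x = a / b"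
    "set fs \<subseteq> R - {0}" "wfactors (mult_of (ring_on R)) fs a"
    "set gs \<subseteq> R - {0}" "wfactors (mult_of (ring_on R)) gs b"
    "boundary R x = int (length fs) - int (length gs)"
    using boundary_value_boundary[OF assms(1,4)] unfolding boundary_value_def by metis
  obtain a' b' fs' gs' where 2: "a' \<in> R - {0}" "b' \<in> R - {0}" "y = a' / b'"
    "set fs' \<subseteq> R - {0}" "wfactors (mult_of (ring_on R)) fs' a'"
    "set gs' \<subseteq> R - {0}" "wfactors (mult_of (ring_on R)) gs' b'"
    "boundary R y = int (length fs') - int (length gs')"
    using boundary_value_boundary[OF assms(2,5)] unfolding boundary_value_def by metis
  have "wfactors (mult_of (ring_on R)) (fs @ fs') (a * a')"
    using mult_of.wfactors_mult[of fs a fs' a'] 1 2 by simp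
  moreover have "wfactors (mult_of (ring_on R)) (gs @ gs') (b * b')"
    using mult_of.wfactors_mult[of gs b gs' b'] 1 2 by simp
  moreover have "a * a' \<in> R - {0}" "b * b' \<in> R - {0}"
    using m_closed[of a a'] m_closed[of b b'] 1 2 by auto
  moreover have "x * y = a * a' / (b * b')" using 1(3) 2(3) by simp
  moreover have "set (fs @ fs') \<subseteq> R - {0}" "set (gs @ gs') \<subseteq> R - {0}" using 1 2 by auto
  moreover have "boundary R x + boundary R y = int (length (fs @ fs')) - int (length (gs @ gs'))"
    using 1(8) 2(8) by simp
  ultimately show "boundary_value R (x * y) (boundary R x + boundary R y)"
    unfolding boundary_value_def by blast
qed (use assms in auto)

lemma boundary_length:
  assumes x: "x \<in> R" "x \<noteq> 0" and fs: "set fs \<subseteq> R - {0}" "wfactors (mult_of (ring_on R)) fs x"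
  shows "boundary R x = int (length fs)"
proof (rule boundary_eqI)
  have "wfactors (mult_of (ring_on R)) [] 1"
    using mult_of.unit_wfactors[of 1] one_mem_hfd mult_of.Units_one_closed by simp
  then show "boundary_value R x (int (length fs))"
    unfolding boundary_value_def using x fs one_mem_hfd
    by (intro exI[of _ x] exI[of _ 1] exI[of _ fs] exI[of _ "[]"]) auto
  show "x \<in> quotient_field R"
    unfolding quotient_field_def using x one_mem_hfd
    by (intro CollectI exI[of _ x] exI[of _ 1]) auto
qed (rule x)

lemma boundary_nonneg: assumes "x \<in> R" "x \<noteq> 0" shows "boundary R x \<ge> 0"
  using wfactors_exist[of x] boundary_length[OF assms] assms by auto

lemma boundary_zero_unit:
  assumes "x \<in> R" "x \<noteq> 0" "boundary R x = 0"
  shows "inverse x \<in> R"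
proof -
  obtain fs where fs: "set fs \<subseteq> R - {0}" "wfactors (mult_of (ring_on R)) fs x"
    using wfactors_exist[of x] assms by auto
  then have "fs = []" using boundary_length[OF assms(1,2)] assms(3) by simp
  then have "1 \<sim>\<^bsub>mult_of (ring_on R)\<^esub> x" using fs(2) by (simp add: wfactors_def)
  then obtain y where "y \<in> R" "1 = x * y" by (auto simp: associated_def factor_def)
  then show ?thesis by (metis inverse_unique)
qed

lemma boundary_pos_factors:
  assumes "x \<in> R" "x \<noteq> 0" "boundary R x > 0"
  shows "\<exists>xs. set xs \<subseteq> R \<and> prod_list xs = x \<and> int (length xs) = boundary R x \<and>
    (\<forall>y\<in>set xs. inverse y \<notin> R)"
proof -
  have "x \<notin> Units (ring_on R)"
  proof
    assume "x \<in> Units (ring_on R)"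
    then have "wfactors (mult_of (ring_on R)) [] x" by (intro mult_of.unit_wfactors) simp
    then show False using boundary_length[OF assms(1,2), of "[]"] assms(3) by simp
  qed
  then obtain fs where fs: "set fs \<subseteq> R - {0}" "factors (mult_of (ring_on R)) fs x"
    using atomic[of x] assms by auto
  have "wfactors (mult_of (ring_on R)) fs x"
    using mult_of.factors_wfactors[OF fs(2)] fs(1) by simp
  then have "int (length fs) = boundary R x"
    using boundary_length[OF assms(1,2) fs(1)] by simp
  moreover have "prod_list fs = x"
  proof -
    have "(\<otimes>\<^bsub>ambient\<^esub>) = ((*) :: 'a \<Rightarrow> 'a \<Rightarrow> 'a)" by (simp add: fun_eq_iff)
    then show ?thesis using fs(2) by (simp add: factors_def prod_list.eq_foldr)
  qed
  moreover have "inverse y \<notin> R" if "y \<in> set fs" for y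
  proof -
    have "y \<notin> Units (ring_on R)" using fs(2) that by (auto simp: factors_def Divisibility.irreducible_def)
    then show ?thesis using fs(1) that by (auto simp: Units_ring_on)
  qed
  ultimately show ?thesis using fs(1) by blast
qed

end

lemma (in integer_order) quotient_field_eq: "quotient_field R = K"
proof (intro equalityI subsetI)
  fix x assume "x \<in> K"
  then obtain n where n: "n > 0" "of_nat n * x \<in> R" by (rule KE)
  then show "x \<in> quotient_field R"
    unfolding quotient_field_def by (intro CollectI exI[of _ "of_nat n * x"] exI[of _ "of_nat n"]) auto
qed (auto simp: quotient_field_def intro!: K_divide[OF R_subset_K R_subset_K])

text \<open>
  Some power \<open>z\<^sup>n\<close> is a unit of \<open>R\<close>, and then \<open>z\<^sup>n\<^sup>-\<^sup>1\<close> times the inverse of \<open>z\<^sup>n\<close> is an inverse of \<open>z\<close> in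
  \<open>A\<close>.
\<close>

theorem theorem2p9:
  fixes D R A :: "'a :: field_char_0 set" and z :: 'a
  assumes "ring_of_algebraic_integers D"
    and "is_order_in R D"
    and "half_factorial_domain (ring_on R)"
    and "subring A ambient" and "R \<subseteq> A" and "A \<subseteq> D"
    and "z \<in> A" and "z \<noteq> 0" and "boundary R z = 0"
  shows "z \<in> Units (ring_on A)"
proof -
  obtain K0 where K0: "ring.finite_dimension ambient \<rat> K0" "D = integral_closure_in \<int> K0"
    using assms(1) by (auto simp: ring_of_algebraic_integers_def)
  have D: "x \<in> K0" "algebraic_int x" if "x \<in> D" for x
    using that K0(2) by (auto simp: integral_closure_in_Ints)
  have RD: "subring R ambient" "R \<subseteq> D" "D \<subseteq> quotient_field R"
    using assms(2) by (auto simp: is_order_in_def integral_closure_in_def)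
  interpret A: field_subring A by (rule field_subring_if_subring) fact
  interpret R: field_subring R by (rule field_subring_if_subring) fact
  interpret R: integer_order R
  proof
    show "\<exists>F. finite F \<and> R \<subseteq> Q.span F"
      using finite_dimension_span[OF K0(1)] D(1) RD(2) by blast
  qed (use RD(2) D(2) in auto)
  interpret R: boundary_order R "boundary R"
    by unfold_locales (use boundary_mult[OF assms(3)] boundary_nonneg[OF assms(3)]
        boundary_zero_unit[OF assms(3)] boundary_pos_factors[OF assms(3)] R.K.mult_mem
        in \<open>auto simp: R.quotient_field_eq\<close>)
  have "z \<in> R.S"
    using assms(6,7) RD(3) D(2) by (intro R.algebraic_int_mem_S) (auto simp flip: R.quotient_field_eq)
  then obtain n where n: "n > 0" "inverse (z ^ n) \<in> R"
    using R.bd_zero_power_unit assms(8,9) by metis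
  then have "z ^ (n - 1) * inverse (z ^ n) \<in> A"
    using assms(5,7) by (intro A.mem) auto
  also have "z ^ (n - 1) * inverse (z ^ n) = inverse z"
    using n(1) assms(8) by (cases n) auto
  finally show ?thesis using assms(7,8) by (simp add: Units_ring_on)
qed

end
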